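(* Let $d\ge3$ be an integer and $p>2$ real. Set $U(x)=|x|^p+x^2$. Then there exist $C,c>0$, depending only on $p$ and $d$, such that for every integer $L\ge2$ the following holds. Suppose that either (i) $\varphi$ is randomly sampled from $\mu_{\mathbb{T}_{2L}^d,U}$ and $v\in V(\mathbb{T}_{2L}^d)\setminus\{\mathbf 0\}$; or (ii) $\varphi$ is randomly sampled from $\mu_{\Lambda_L^d,U}$ and $v\in V(\Lambda_L^d)\setminus V_0$, where $V_0$ is the boundary of the box $\Lambda_L^d$. Then for all $t>2$, $$\mathbb{P}(|\varphi(v)|>t)\le\begin{cases}C\exp(-c\,t^d)& d<p,\\ C\exp\left(-c\,\frac{t^d}{(\log t)^{d-1}}\right)& d=p,\\ C\exp(-c\,t^p)& d>p.\end{cases}$$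
   Context: Random surface measure: for a finite connected graph $G$, a set $\varnothing\ne V_0\subsetneq V(G)$, and even $U$, fix an arbitrary orientation of the edges and let $\nabla_e\varphi=\varphi(u)-\varphi(w)$ for $e=(u,w)$ (the choice is immaterial as $U$ is even). The random surface measure on $G$ with potential $U$ and zero boundary values on $V_0$ is the probability measure on functions $\varphi:V(G)\to\mathbb{R}$ with $\varphi|_{V_0}\equiv0$ whose density, with respect to Lebesgue measure $\prod_{v\in V(G)\setminus V_0}d\varphi(v)$, is $\frac1Z\exp\big(-\sum_{e\in E(G)}U(\nabla_e\varphi)\big)$, where $Z\in(0,\infty)$ is the normalization constant. Torus: $\mathbb{T}_{2L}^d$ has vertex set $\{-L+1,\ldots,L-1,L\}^d$, where $v,w$ are adjacent when they are equal in all but one coordinate and differ by exactly one modulo $2L$ in that coordinate; $\mu_{\mathbb{T}_{2L}^d,U}$ is the random surface measure on $G=\mathbb{T}_{2L}^d$ with potential $U$ and zero boundary values on $V_0=\{\mathbf 0\}$, $\mathbf 0=(0,\ldots,0)$, i.e., the probability measure on functions $\varphi:V(\mathbb{T}_{2L}^d)\to\mathbb{R}$ with $\varphi(\mathbf 0)=0$ whose density with respect to $\prod_{v\in V(\mathbb{T}_{2L}^d)\setminus\{\mathbf 0\}}d\varphi(v)$ is proportional to $\exp\big(-\sum_{e\in E(\mathbb{T}_{2L}^d)}U(\nabla_e\varphi)\big)$. Box: $\Lambda_L^d$ has vertex set $\{1,\ldots,L\}^d\subset\mathbb{Z}^d$ with the nearest-neighbor adjacency of $\mathbb{Z}^d$;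 $\mu_{\Lambda_L^d,U}$ is the random surface measure on $G=\Lambda_L^d$ with potential $U$ and zero boundary values on $V_0$, where $V_0$ is the set of vertices of $\{1,\ldots,L\}^d$ which are adjacent in $\mathbb{Z}^d$ to a vertex outside $\{1,\ldots,L\}^d$, i.e., the probability measure on functions $\varphi:V(\Lambda_L^d)\to\mathbb{R}$ with $\varphi|_{V_0}\equiv0$ whose density with respect to $\prod_{v\in V(\Lambda_L^d)\setminus V_0}d\varphi(v)$ is proportional to $\exp\big(-\sum_{e\in E(\Lambda_L^d)}U(\nabla_e\varphi)\big)$ (a vertex $v$ as in (ii) exists only when $V(\Lambda_L^d)\setminus V_0\neq\varnothing$). *)

theory Defs
  imports "HOL-Probability.Probability" "HOL-Number_Theory.Cong"
begin

section \<open>Random surface measures\<close>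

text \<open>A finite simple graph is given by its vertex set \<open>V\<close> and its set \<open>E\<close> of edges, which are
  unordered pairs \<open>{u, w}\<close> of distinct vertices.\<close>

definition is_orientation :: "'v set set \<Rightarrow> ('v set \<Rightarrow> 'v \<times> 'v) \<Rightarrow> bool" where
  "is_orientation E \<omega> \<longleftrightarrow> (\<forall>e\<in>E. e = {fst (\<omega> e), snd (\<omega> e)})"

definition edge_gradient :: "('v set \<Rightarrow> 'v \<times> 'v) \<Rightarrow> ('v \<Rightarrow> real) \<Rightarrow> 'v set \<Rightarrow> real" where
  "edge_gradient \<omega> \<phi> e = \<phi> (fst (\<omega> e)) - \<phi> (snd (\<omega> e))"

text \<open>The orientation is arbitrary; \<open>surface_energy_orientation\<close> below shows that the energy does
  not depend on it when the potential is even.\<close>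

definition surface_energy :: "(real \<Rightarrow> real) \<Rightarrow> 'v set set \<Rightarrow> ('v \<Rightarrow> real) \<Rightarrow> real" where
  "surface_energy U E \<phi> = (\<Sum>e\<in>E. U (edge_gradient (SOME \<omega>. is_orientation E \<omega>) \<phi> e))"

text \<open>Lebesgue measure in the coordinates outside \<open>V\<^sub>0\<close>, carried to the functions on \<open>V\<close> that
  vanish on \<open>V\<^sub>0\<close>.\<close>

definition zero_boundary_lebesgue :: "'v set \<Rightarrow> 'v set \<Rightarrow> ('v \<Rightarrow> real) measure" where
  "zero_boundary_lebesgue V V\<^sub>0 =
     distr (\<Pi>\<^sub>M v\<in>V - V\<^sub>0. lborel) (\<Pi>\<^sub>M v\<in>V. borel)
       (\<lambda>\<phi>. \<lambda>v\<in>V. if v \<in> V\<^sub>0 then 0 else \<phi> v)"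

definition partition_function ::
    "'v set \<Rightarrow> 'v set set \<Rightarrow> (real \<Rightarrow> real) \<Rightarrow> 'v set \<Rightarrow> ennreal" where
  "partition_function V E U V\<^sub>0 =
     (\<integral>\<^sup>+\<phi>. ennreal (exp (- surface_energy U E \<phi>)) \<partial>zero_boundary_lebesgue V V\<^sub>0)"

definition random_surface_measure ::
    "'v set \<Rightarrow> 'v set set \<Rightarrow> (real \<Rightarrow> real) \<Rightarrow> 'v set \<Rightarrow> ('v \<Rightarrow> real) measure" where
  "random_surface_measure V E U V\<^sub>0 =
     density (zero_boundary_lebesgue V V\<^sub>0)
       (\<lambda>\<phi>. ennreal (exp (- surface_energy U E \<phi>)) / partition_function V E U V\<^sub>0)"

lemma surface_energy_orientation:
  assumes "is_orientation E \<omega>" and even: "\<And>x. U (- x) = U x"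
  shows "surface_energy U E \<phi> = (\<Sum>e\<in>E. U (edge_gradient \<omega> \<phi> e))"
proof -
  define \<eta> where "\<eta> = (SOME \<omega>. is_orientation E \<omega>)"
  have \<eta>: "is_orientation E \<eta>"
    unfolding \<eta>_def using someI[of "is_orientation E", OF assms(1)] by simp
  have "U (edge_gradient \<eta> \<phi> e) = U (edge_gradient \<omega> \<phi> e)" if "e \<in> E" for e
  proof -
    have "{fst (\<eta> e), snd (\<eta> e)} = {fst (\<omega> e), snd (\<omega> e)}"
      using that \<eta> assms(1) unfolding is_orientation_def by metis
    then have "edge_gradient \<eta> \<phi> e = edge_gradient \<omega> \<phi> e \<or>
        edge_gradient \<eta> \<phi> e = - edge_gradient \<omega> \<phi> e"
      by (auto simp: edge_gradient_def doubleton_eq_iff)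
    then show ?thesis using even by auto
  qed
  then show ?thesis unfolding surface_energy_def \<eta>_def by (intro sum.cong) auto
qed


section \<open>Torus and box\<close>

text \<open>Points of \<open>\<int>\<^sup>d\<close> are functions on \<open>{..<d}\<close>, extended by \<open>undefined\<close> outside, so that each
  point has exactly one representative.\<close>

definition int_lattice :: "nat \<Rightarrow> (nat \<Rightarrow> int) set" where
  "int_lattice d = (\<Pi>\<^sub>E i\<in>{..<d}. UNIV)"

definition lattice_origin :: "nat \<Rightarrow> nat \<Rightarrow> int" where
  "lattice_origin d = (\<lambda>i\<in>{..<d}. 0)"

definition lattice_adj :: "nat \<Rightarrow> (nat \<Rightarrow> int) \<Rightarrow> (nat \<Rightarrow> int) \<Rightarrow> bool" where
  "lattice_adj d v w \<longleftrightarrow>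
     (\<exists>i<d. \<bar>v i - w i\<bar> = 1 \<and> (\<forall>j<d. j \<noteq> i \<longrightarrow> v j = w j))"

definition edges_of :: "'v set \<Rightarrow> ('v \<Rightarrow> 'v \<Rightarrow> bool) \<Rightarrow> 'v set set" where
  "edges_of V adj = {{v, w} | v w. v \<in> V \<and> w \<in> V \<and> adj v w}"

text \<open>The parameter \<open>L\<close> is the half side length: the torus below has side length \<open>2L\<close>.\<close>

definition torus_vertices :: "nat \<Rightarrow> nat \<Rightarrow> (nat \<Rightarrow> int) set" where
  "torus_vertices d L = (\<Pi>\<^sub>E i\<in>{..<d}. {- int L + 1..int L})"

definition torus_adj :: "nat \<Rightarrow> nat \<Rightarrow> (nat \<Rightarrow> int) \<Rightarrow> (nat \<Rightarrow> int) \<Rightarrow> bool" where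
  "torus_adj d L v w \<longleftrightarrow>
     (\<exists>i<d. ([v i - w i = 1] (mod (2 * int L)) \<or> [v i - w i = - 1] (mod (2 * int L))) \<and>
        (\<forall>j<d. j \<noteq> i \<longrightarrow> v j = w j))"

definition torus_surface_measure ::
    "nat \<Rightarrow> nat \<Rightarrow> (real \<Rightarrow> real) \<Rightarrow> ((nat \<Rightarrow> int) \<Rightarrow> real) measure" where
  "torus_surface_measure d L U =
     random_surface_measure (torus_vertices d L)
       (edges_of (torus_vertices d L) (torus_adj d L)) U {lattice_origin d}"

definition box_vertices :: "nat \<Rightarrow> nat \<Rightarrow> (nat \<Rightarrow> int) set" where
  "box_vertices d L = (\<Pi>\<^sub>E i\<in>{..<d}. {1..int L})"

definition box_boundary :: "nat \<Rightarrow> nat \<Rightarrow> (nat \<Rightarrow> int) set" where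
  "box_boundary d L =
     {v \<in> box_vertices d L. \<exists>w \<in> int_lattice d - box_vertices d L. lattice_adj d v w}"

definition box_surface_measure ::
    "nat \<Rightarrow> nat \<Rightarrow> (real \<Rightarrow> real) \<Rightarrow> ((nat \<Rightarrow> int) \<Rightarrow> real) measure" where
  "box_surface_measure d L U =
     random_surface_measure (box_vertices d L)
       (edges_of (box_vertices d L) (lattice_adj d)) U (box_boundary d L)"

end

theory Submission
  imports Defs
begin

text \<open>
  For \<open>p \<ge> 2\<close>, Clarkson's inequality gives
  \<open>U ((a - b) / 2) + U ((a + b) / 2) \<le> (U a + U b) / 2\<close>, so the energy \<open>H\<close> satisfies
  \<open>H ((x - y) / 2) \<le> (H x + H y) / 2 - H ((x + y) / 2)\<close>. Applying the Prekopa-Leindler inequality to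
  \<open>exp (- H)\<close> restricted to the event \<open>\<phi> v > t\<close> (and to its reflection) bounds the probability of this event by
  \<open>exp (- R)\<close>, where \<open>R\<close> is the least energy of a function \<open>h\<close> with zero boundary values and \<open>\<bar>h v\<bar> > t\<close>.
  No dimensional constant is lost, so it remains to bound \<open>R\<close> below uniformly in \<open>L\<close>.

  Extend \<open>h\<close> to \<open>\<int>\<^sup>d\<close>, periodically for the torus and by zero for the box. Comparing averages over dyadic cubes gives
  \<open>t \<le> C * (\<Sum>j. 2^(j * (1 - d)) * S j)\<close>, where \<open>S j\<close> is the sum of \<open>\<bar>\<nabla>h\<bar>\<close> over a cube of side \<open>2^j\<close>.
  Discard the gradients below a threshold \<open>y j\<close> with
  \<open>max (y j powr (p - 1)) (y j) \<ge> \<lambda> * 2^(j * (1 - d))\<close>; if \<open>\<lambda>\<close> is a small multiple of (rate / \<open>t\<close>), they contribute at most half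
  of the sum. On the remaining edges \<open>U \<bar>\<nabla>h\<bar> \<ge> \<lambda> * 2^(j * (1 - d)) * \<bar>\<nabla>h\<bar>\<close>, so that \<open>H h\<close> is at least of order
  \<open>\<lambda> * t\<close>.
\<close>


section \<open>The Prekopa-Leindler inequality\<close>

text \<open>Some increasing sequence in \<open>A\<close> is cofinal in \<open>A\<close>, so
  continuity from below applies. Truncating at points of \<open>A\<close> itself gives every
  truncated set a largest element, which the proof of \<open>Brunn_Minkowski_real\<close> pairs with
  the other set.\<close>

lemma emeasure_lborel_truncations:
  fixes A :: "real set"
  assumes "A \<in> sets borel" "A \<noteq> {}"
  shows "emeasure lborel A = (SUP a\<in>A. emeasure lborel (A \<inter> {..a}))"
proof (rule antisym)
  have "\<exists>f :: nat \<Rightarrow> real. incseq f \<and> (\<forall>n. f n \<in> A) \<and> (\<forall>x\<in>A. \<exists>n. x \<le> f n)"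
  proof (cases "\<exists>m\<in>A. \<forall>x\<in>A. x \<le> m")
    case True
    then obtain m where "m \<in> A" "\<forall>x\<in>A. x \<le> m" by blast
    then show ?thesis by (intro exI[of _ "\<lambda>_. m"]) auto
  next
    case False
    have "\<exists>g :: nat \<Rightarrow> real. (\<forall>n. g n \<in> A) \<and> (\<forall>x\<in>A. \<exists>n. x \<le> g n)"
    proof (cases "bdd_above A")
      case True
      have "\<exists>y\<in>A. Sup A - 1 / real (Suc n) < y" for n
        using less_cSup_iff[OF assms(2) True, of "Sup A - 1 / real (Suc n)"] by simp
      then obtain g where g: "\<And>n. g n \<in> A" "\<And>n. Sup A - 1 / real (Suc n) < g n" by metis
      have "\<exists>n. x \<le> g n" if x: "x \<in> A" for x
      proof -
        obtain m where m: "m \<in> A" "x < m" using False x by force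
        have "m \<le> Sup A" using True m by (simp add: cSup_upper)
        then have "Sup A - x > 0" using m by simp
        then obtain n where "1 / real (Suc n) < Sup A - x" using nat_approx_posE by blast
        then show ?thesis using g(2)[of n] by (intro exI[of _ n]) linarith
      qed
      then show ?thesis using g by blast
    next
      case False
      then have "\<exists>y\<in>A. real n \<le> y" for n
        unfolding bdd_above_def by (meson linear)
      then obtain g where g: "\<And>n. g n \<in> A" "\<And>n. real n \<le> g n" by metis
      have "\<exists>n. x \<le> g n" for x
        using g(2) real_arch_simple[of x] order_trans by blast
      then show ?thesis using g by blast
    qed
    then obtain g :: "nat \<Rightarrow> real" where g: "\<And>n. g n \<in> A" "\<And>x. x \<in> A \<Longrightarrow> \<exists>n. x \<le> g n" by blast
    \<comment> \<open>Running maxima make the cofinal sequence increasing without leaving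
      \<open>A\<close>.\<close>
    define f where "f n = Max (g ` {..n})" for n
    have "f n \<in> A" for n
    proof -
      have "f n \<in> g ` {..n}" unfolding f_def by (intro Max_in) auto
      then show ?thesis using g(1) by auto
    qed
    moreover have "incseq f"
      unfolding incseq_def f_def by (auto intro!: Max_mono)
    moreover have "\<exists>n. x \<le> f n" if x: "x \<in> A" for x
    proof -
      obtain n where "x \<le> g n" using g(2) x by blast
      also have "g n \<le> f n" unfolding f_def by (intro Max_ge) auto
      finally show ?thesis by blast
    qed
    ultimately show ?thesis by blast
  qed
  then obtain f :: "nat \<Rightarrow> real" where f: "incseq f" "\<And>n. f n \<in> A" "\<And>x. x \<in> A \<Longrightarrow> \<exists>n. x \<le> f n" by blast
  have "A = (\<Union>n. A \<inter> {..f n})" using f(3) by auto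
  then have "emeasure lborel A = emeasure lborel (\<Union>n. A \<inter> {..f n})" by simp
  also have "\<dots> = (SUP n. emeasure lborel (A \<inter> {..f n}))"
    using assms f(1)
    by (intro SUP_emeasure_incseq[symmetric]) (auto simp: incseq_def intro: order_trans)
  also have "\<dots> \<le> (SUP a\<in>A. emeasure lborel (A \<inter> {..a}))"
    using f(2) by (intro SUP_least SUP_upper) auto
  finally show "emeasure lborel A \<le> (SUP a\<in>A. emeasure lborel (A \<inter> {..a}))" .
next
  show "(SUP a\<in>A. emeasure lborel (A \<inter> {..a})) \<le> emeasure lborel A"
    using assms by (intro SUP_least emeasure_mono) auto
qed

text \<open>Differences instead of sums: this builds the reflection \<open>y \<mapsto> - y\<close> into the inequality and so replaces the
  symmetry of the random surface measure.\<close>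

lemma Brunn_Minkowski_real:
  fixes A B C :: "real set"
  assumes [measurable]: "A \<in> sets borel" "B \<in> sets borel" "C \<in> sets borel"
    and ne: "A \<noteq> {}" "B \<noteq> {}"
    and diff: "\<And>x y. x \<in> A \<Longrightarrow> y \<in> B \<Longrightarrow> (x - y) / 2 \<in> C"
  shows "emeasure lborel A + emeasure lborel B \<le> 2 * emeasure lborel C"
proof -
  have step: "emeasure lborel (A \<inter> {..a}) + emeasure lborel (B \<inter> {..b}) \<le> 2 * emeasure lborel C"
    if a: "a \<in> A" and b: "b \<in> B" for a b
  proof -
    \<comment> \<open>The scaled copies of \<open>A'\<close> and \<open>B'\<close> lie on opposite sides of \<open>(a - b) / 2\<close>.\<close>
    define A' where "A' = A \<inter> {..a}"
    define B' where "B' = B \<inter> {..<b}"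
    have [measurable]: "A' \<in> sets borel" "B' \<in> sets borel" unfolding A'_def B'_def by auto
    define C1 where "C1 = (\<lambda>z. b + 2 * z) -` A' \<inter> space borel"
    define C2 where "C2 = (\<lambda>z. a + (-2) * z) -` B' \<inter> space borel"
    have [measurable]: "C1 \<in> sets borel" "C2 \<in> sets borel" unfolding C1_def C2_def
      by (rule measurable_sets[where M = borel and A = borel]; measurable)+
    have scale: "emeasure lborel X = 2 * emeasure lborel ((\<lambda>z. s + c * z) -` X \<inter> space borel)"
      if [measurable]: "X \<in> sets borel" and c: "\<bar>c\<bar> = 2" for X :: "real set" and s c
    proof -
      have "c \<noteq> 0" using c by auto
      from lborel_real_affine[OF this, of s]
      have "emeasure lborel X = emeasure (density (distr lborel borel (\<lambda>x. s + c * x)) (\<lambda>_. ennreal \<bar>c\<bar>)) X"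
        by (rule arg_cong)
      also have "\<dots> = 2 * emeasure lborel ((\<lambda>z. s + c * z) -` X \<inter> space borel)"
        using c by (simp add: emeasure_density nn_integral_cmult_indicator emeasure_distr)
      finally show ?thesis .
    qed
    \<comment> \<open>Dropping the null point \<open>b\<close> makes \<open>C1\<close> and
      \<open>C2\<close> disjoint: \<open>z \<le> (a - b) / 2\<close> on \<open>C1\<close>, and the
      strict reverse on \<open>C2\<close>.\<close>
    have "emeasure lborel (B \<inter> {..b}) = emeasure lborel B'"
    proof (rule emeasure_eq_AE)
      show "AE x in lborel. (x \<in> B \<inter> {..b}) = (x \<in> B')"
        using AE_lborel_singleton[of b] by eventually_elim (auto simp: B'_def)
    qed auto
    then have "emeasure lborel (A \<inter> {..a}) + emeasure lborel (B \<inter> {..b})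
        = 2 * (emeasure lborel C1 + emeasure lborel C2)"
      using scale[of A' 2 b] scale[of B' "-2" a] unfolding C1_def C2_def A'_def[symmetric]
      by (simp add: distrib_left)
    also have "emeasure lborel C1 + emeasure lborel C2 = emeasure lborel (C1 \<union> C2)"
      by (intro plus_emeasure) (auto simp: C1_def C2_def A'_def B'_def)
    also have "\<dots> \<le> emeasure lborel C"
    proof (intro emeasure_mono)
      show "C1 \<union> C2 \<subseteq> C"
      proof
        fix z assume "z \<in> C1 \<union> C2"
        then show "z \<in> C"
          using diff[of "b + 2 * z" b] diff[of a "a + (-2) * z"] a b
          by (auto simp: C1_def C2_def A'_def B'_def)
      qed
    qed auto
    finally show ?thesis by (simp add: mult_left_mono)
  qed
  have "emeasure lborel A + emeasure lborel B
      = (SUP a\<in>A. emeasure lborel (A \<inter> {..a})) + (SUP b\<in>B. emeasure lborel (B \<inter> {..b}))"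
    using emeasure_lborel_truncations[of A] emeasure_lborel_truncations[of B] ne by simp
  also have "\<dots> = (SUP b\<in>B. SUP a\<in>A. emeasure lborel (A \<inter> {..a}) + emeasure lborel (B \<inter> {..b}))"
    using ne by (simp add: ennreal_SUP_add_left ennreal_SUP_add_right)
  also have "\<dots> \<le> 2 * emeasure lborel C"
    using step by (intro SUP_least) auto
  finally show ?thesis .
qed

text \<open>Every value, including \<open>\<top>\<close>, is the length of the set of positive
  levels below it. Tonelli then exchanges level and point.\<close>

lemma nn_integral_layer_cake:
  fixes f :: "real \<Rightarrow> ennreal"
  assumes [measurable]: "f \<in> borel_measurable borel"
  shows "(\<integral>\<^sup>+x. f x \<partial>lborel) = (\<integral>\<^sup>+s. indicator {0<..} s * emeasure lborel {x. ennreal s < f x} \<partial>lborel)"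
proof -
  have layer: "c = (\<integral>\<^sup>+s. indicator {s. 0 < s \<and> ennreal s < c} (s::real) \<partial>lborel)" for c :: ennreal
  proof (cases c)
    case (real r)
    then have "{s. 0 < s \<and> ennreal s < c} = {0<..<r}"
      by (auto simp: ennreal_less_iff)
    then show ?thesis using real by simp
  next
    case top
    then have "{s. 0 < s \<and> ennreal s < c} = {0<..}" by auto
    moreover have "emeasure lborel {(0::real)<..} = \<top>"
    proof -
      have "of_nat n \<le> emeasure lborel {(0::real)<..}" for n
      proof -
        have "emeasure lborel {0<..real n} \<le> emeasure lborel {(0::real)<..}"
          by (intro emeasure_mono) auto
        then show ?thesis by (simp add: ennreal_of_nat_eq_real_of_nat)
      qed
      then have "(SUP n. of_nat n) \<le> emeasure lborel {(0::real)<..}" by (intro SUP_least)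
      then show ?thesis by (simp add: ennreal_SUP_of_nat_eq_top top_unique)
    qed
    ultimately show ?thesis using top by simp
  qed
  have "(\<integral>\<^sup>+x. f x \<partial>lborel) = (\<integral>\<^sup>+x. (\<integral>\<^sup>+s. indicator {s. 0 < s \<and> ennreal s < f x} (s::real) \<partial>lborel) \<partial>lborel)"
    using layer by (intro nn_integral_cong) simp
  also have "\<dots> = (\<integral>\<^sup>+x. (\<integral>\<^sup>+s. indicator {0<..} s * indicator {x. ennreal s < f x} x \<partial>lborel) \<partial>lborel)"
    by (intro nn_integral_cong) (auto simp: indicator_def)
  also have "\<dots> = (\<integral>\<^sup>+s. (\<integral>\<^sup>+x. indicator {0<..} s * indicator {x. ennreal s < f x} x \<partial>lborel) \<partial>lborel)"
    by (intro lborel_pair.Fubini') (auto simp: indicator_def split_beta)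
  also have "\<dots> = (\<integral>\<^sup>+s. indicator {0<..} s * emeasure lborel {x. ennreal s < f x} \<partial>lborel)"
    by (intro nn_integral_cong) (simp add: nn_integral_cmult_indicator)
  finally show ?thesis .
qed


text \<open>AM-GM; it turns the additive bound for functions with equal suprema into the
  multiplicative one.\<close>

lemma ennreal_mult_le_power2_of_add_le:
  fixes x y z :: ennreal
  assumes "x + y \<le> 2 * z"
  shows "x * y \<le> z\<^sup>2"
proof (cases z)
  case (real c)
  then have "x + y \<le> ennreal (2 * c)" using assms by (simp add: ennreal_mult)
  then have "x < \<top>" "y < \<top>"
    by (auto simp: less_top[symmetric] top_unique)
  then obtain a b where ab: "x = ennreal a" "0 \<le> a" "y = ennreal b" "0 \<le> b"
    by (cases x; cases y) auto
  have "a + b \<le> 2 * c" using \<open>x + y \<le> ennreal (2 * c)\<close> ab real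
    by (simp add: ennreal_plus[symmetric] del: ennreal_plus)
  then have "(a + b)\<^sup>2 \<le> (2 * c)\<^sup>2" using ab by (intro power_mono) auto
  then have "a * b \<le> c\<^sup>2" using zero_le_power2[of "a - b"] by (simp add: power2_eq_square algebra_simps)
  then show ?thesis using ab real by (simp add: ennreal_mult[symmetric] ennreal_power)
qed (simp add: ennreal_top_mult power2_eq_square)

text \<open>Equal suprema make the superlevel sets of \<open>u\<close> and \<open>v\<close> nonempty
  at exactly the same heights, so one-dimensional Brunn-Minkowski applies at each height and the
  layer-cake formula integrates the result. Squaring \<open>w\<close> avoids roots of extended
  reals.\<close>

lemma Prekopa_Leindler_real_balanced:
  fixes u v w :: "real \<Rightarrow> ennreal"
  assumes [measurable]: "u \<in> borel_measurable borel" "v \<in> borel_measurable borel" "w \<in> borel_measurable borel"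
    and le: "\<And>x y. u x * v y \<le> (w ((x - y) / 2))\<^sup>2"
    and sup: "(SUP x. u x) = (SUP x. v x)"
  shows "(\<integral>\<^sup>+x. u x \<partial>lborel) + (\<integral>\<^sup>+x. v x \<partial>lborel) \<le> 2 * (\<integral>\<^sup>+x. w x \<partial>lborel)"
proof -
  have levels: "emeasure lborel {x. ennreal s < u x} + emeasure lborel {x. ennreal s < v x}
      \<le> 2 * emeasure lborel {x. ennreal s < w x}" if "s > 0" for s
  proof (cases "ennreal s < (SUP x. u x)")
    case True
    show ?thesis
    proof (rule Brunn_Minkowski_real)
      show "{x. ennreal s < u x} \<noteq> {}" "{x. ennreal s < v x} \<noteq> {}"
        using True True[unfolded sup] by (auto simp: less_SUP_iff)
    next
      fix x y assume xy: "x \<in> {x. ennreal s < u x}" "y \<in> {x. ennreal s < v x}"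
      have "ennreal s * ennreal s < ennreal s * v y"
        using xy that by (intro ennreal_mult_strict_left_mono) auto
      also have "\<dots> \<le> u x * v y" using xy by (intro mult_right_mono) auto
      also have "\<dots> \<le> (w ((x - y) / 2))\<^sup>2" by (rule le)
      finally have "ennreal s < w ((x - y) / 2)"
        by (metis leD leI mult_mono power2_eq_square zero_le)
      then show "(x - y) / 2 \<in> {x. ennreal s < w x}" by simp
    qed auto
  next
    case False
    then have "\<not> ennreal s < (SUP x. v x)" using sup by simp
    with False have "{x. ennreal s < u x} = {}" "{x. ennreal s < v x} = {}"
      unfolding less_SUP_iff by auto
    then show ?thesis by simp
  qed
  have "(\<integral>\<^sup>+x. u x \<partial>lborel) + (\<integral>\<^sup>+x. v x \<partial>lborel)
      = (\<integral>\<^sup>+s. indicator {0<..} s * emeasure lborel {x. ennreal s < u x}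
           + indicator {0<..} s * emeasure lborel {x. ennreal s < v x} \<partial>lborel)"
    by (simp add: nn_integral_layer_cake[of u] nn_integral_layer_cake[of v] nn_integral_add)
  also have "\<dots> \<le> (\<integral>\<^sup>+s. 2 * (indicator {0<..} s * emeasure lborel {x. ennreal s < w x}) \<partial>lborel)"
    using levels by (intro nn_integral_mono) (auto simp: indicator_def)
  also have "\<dots> = 2 * (\<integral>\<^sup>+x. w x \<partial>lborel)"
    by (simp add: nn_integral_layer_cake[of w] nn_integral_cmult)
  finally show ?thesis .
qed

text \<open>Multiplying \<open>u\<close> by \<open>s\<close> and \<open>v\<close> by
  \<open>1 / s\<close> preserves both the hypothesis and the product of integrals, and
  \<open>s = sqrt (b / a)\<close> equalises positive finite suprema. If a supremum is zero, one
  integral vanishes.\<close>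

lemma Prekopa_Leindler_real_bounded:
  fixes u v w :: "real \<Rightarrow> ennreal"
  assumes [measurable]: "u \<in> borel_measurable borel" "v \<in> borel_measurable borel" "w \<in> borel_measurable borel"
    and le: "\<And>x y. u x * v y \<le> (w ((x - y) / 2))\<^sup>2"
    and fin: "(SUP x. u x) < \<top>" "(SUP x. v x) < \<top>"
  shows "(\<integral>\<^sup>+x. u x \<partial>lborel) * (\<integral>\<^sup>+x. v x \<partial>lborel) \<le> (\<integral>\<^sup>+x. w x \<partial>lborel)\<^sup>2"
proof (cases "(SUP x. u x) = 0 \<or> (SUP x. v x) = 0")
  case True
  then have "(\<forall>x. u x = 0) \<or> (\<forall>x. v x = 0)" by (auto simp: bot_ennreal[symmetric])
  then show ?thesis by auto
next
  case False
  then obtain a b where ab: "(SUP x. u x) = ennreal a" "(SUP x. v x) = ennreal b" "a > 0" "b > 0"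
    using fin by (cases "SUP x. u x"; cases "SUP x. v x") (auto simp: le_less)
  define s where "s = sqrt (b / a)"
  have s: "s > 0" "s * a = 1 / s * b"
  proof -
    show "s > 0" using ab by (simp add: s_def)
    have "s * s = b / a" using ab by (simp add: s_def)
    then show "s * a = 1 / s * b" using \<open>s > 0\<close> ab by (simp add: field_simps)
  qed
  have s1: "ennreal s * ennreal (1 / s) = 1"
    using s by (simp add: ennreal_mult[symmetric])
  have prod: "(ennreal s * X) * (ennreal (1 / s) * Y) = X * Y" for X Y
  proof -
    have "(ennreal s * X) * (ennreal (1 / s) * Y) = (ennreal s * ennreal (1 / s)) * (X * Y)"
      by (simp only: ac_simps)
    then show ?thesis using s1 by simp
  qed
  have "(\<integral>\<^sup>+x. ennreal s * u x \<partial>lborel) + (\<integral>\<^sup>+x. ennreal (1 / s) * v x \<partial>lborel)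
      \<le> 2 * (\<integral>\<^sup>+x. w x \<partial>lborel)"
  proof (rule Prekopa_Leindler_real_balanced)
    show "(SUP x. ennreal s * u x) = (SUP x. ennreal (1 / s) * v x)"
      using s ab by (simp add: SUP_mult_left_ennreal[symmetric] ennreal_mult[symmetric])
  qed (use le prod in simp_all)
  then have "(\<integral>\<^sup>+x. ennreal s * u x \<partial>lborel) * (\<integral>\<^sup>+x. ennreal (1 / s) * v x \<partial>lborel)
      \<le> (\<integral>\<^sup>+x. w x \<partial>lborel)\<^sup>2"
    by (rule ennreal_mult_le_power2_of_add_le)
  then show ?thesis by (simp add: nn_integral_cmult prod)
qed

lemma SUP_min_of_nat: "(SUP n. min x (of_nat n)) = (x :: ennreal)"
  using inf_SUP[of x "\<lambda>n::nat. of_nat n :: ennreal" UNIV]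
  by (simp add: inf_min ennreal_SUP_of_nat_eq_top)

text \<open>Truncating \<open>u\<close> and \<open>v\<close> from above only weakens the pointwise
  requirement; monotone convergence removes the truncation.\<close>

lemma Prekopa_Leindler_real:
  fixes u v w :: "real \<Rightarrow> ennreal"
  assumes [measurable]: "u \<in> borel_measurable borel" "v \<in> borel_measurable borel" "w \<in> borel_measurable borel"
    and le: "\<And>x y. u x * v y \<le> (w ((x - y) / 2))\<^sup>2"
  shows "(\<integral>\<^sup>+x. u x \<partial>lborel) * (\<integral>\<^sup>+x. v x \<partial>lborel) \<le> (\<integral>\<^sup>+x. w x \<partial>lborel)\<^sup>2"
proof -
  define trunc where "trunc f n x = min (f x) (of_nat n)" for f :: "real \<Rightarrow> ennreal" and n :: nat and x
  have int: "(\<integral>\<^sup>+x. f x \<partial>lborel) = (SUP n. \<integral>\<^sup>+x. trunc f n x \<partial>lborel)"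
    if [measurable]: "f \<in> borel_measurable borel" for f
  proof -
    have "incseq (\<lambda>n x. trunc f n x)"
      by (auto simp: incseq_def le_fun_def trunc_def min_le_iff_disj intro: order_trans)
    then have "(\<integral>\<^sup>+x. (SUP n. trunc f n x) \<partial>lborel) = (SUP n. \<integral>\<^sup>+x. trunc f n x \<partial>lborel)"
      by (intro nn_integral_monotone_convergence_SUP) (auto simp: trunc_def)
    then show ?thesis by (simp add: trunc_def SUP_min_of_nat)
  qed
  have fin: "(SUP x. trunc f n x) < \<top>" for f n
  proof -
    have "(SUP x. trunc f n x) \<le> of_nat n" by (intro SUP_least) (auto simp: trunc_def)
    also have "\<dots> < \<top>" by (simp add: of_nat_less_top)
    finally show ?thesis .
  qed
  have "(\<integral>\<^sup>+x. u x \<partial>lborel) * (\<integral>\<^sup>+x. v x \<partial>lborel)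
      = (SUP m. SUP n. (\<integral>\<^sup>+x. trunc u n x \<partial>lborel) * (\<integral>\<^sup>+x. trunc v m x \<partial>lborel))"
    by (simp add: int SUP_mult_left_ennreal SUP_mult_right_ennreal)
  also have "\<dots> \<le> (\<integral>\<^sup>+x. w x \<partial>lborel)\<^sup>2"
  proof (intro SUP_least Prekopa_Leindler_real_bounded fin)
    fix m n x y
    have "trunc u n x * trunc v m y \<le> u x * v y" by (intro mult_mono) (auto simp: trunc_def)
    then show "trunc u n x * trunc v m y \<le> (w ((x - y) / 2))\<^sup>2" using le order_trans by blast
  qed (auto simp: trunc_def)
  finally show ?thesis .
qed

text \<open>Induction on the coordinates: the one-dimensional inequality in coordinate
  \<open>j\<close> is exactly the pointwise hypothesis for the slice integrals, to which the
  induction hypothesis applies. No dimensional factor arises.\<close>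

lemma Prekopa_Leindler_PiM:
  fixes u v w :: "('i \<Rightarrow> real) \<Rightarrow> ennreal"
  assumes "finite I"
    and "u \<in> borel_measurable (\<Pi>\<^sub>M i\<in>I. lborel)"
    and "v \<in> borel_measurable (\<Pi>\<^sub>M i\<in>I. lborel)"
    and "w \<in> borel_measurable (\<Pi>\<^sub>M i\<in>I. lborel)"
    and "\<And>x y. x \<in> extensional I \<Longrightarrow> y \<in> extensional I \<Longrightarrow>
           u x * v y \<le> (w (\<lambda>i\<in>I. (x i - y i) / 2))\<^sup>2"
  shows "(\<integral>\<^sup>+x. u x \<partial>(\<Pi>\<^sub>M i\<in>I. lborel)) * (\<integral>\<^sup>+x. v x \<partial>(\<Pi>\<^sub>M i\<in>I. lborel))
    \<le> (\<integral>\<^sup>+x. w x \<partial>(\<Pi>\<^sub>M i\<in>I. lborel))\<^sup>2"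
  using assms
proof (induction I arbitrary: u v w rule: finite_induct)
  case empty
  interpret product_sigma_finite "\<lambda>_. lborel :: real measure" by standard
  have "u (\<lambda>k. undefined) * v (\<lambda>k. undefined) \<le> (w (\<lambda>k. undefined))\<^sup>2"
    using empty(4)[of "\<lambda>k. undefined" "\<lambda>k. undefined"] by (simp add: restrict_def)
  then show ?case by (simp add: nn_integral_empty)
next
  case (insert j I)
  interpret product_sigma_finite "\<lambda>_. lborel :: real measure" by standard
  note [measurable] = insert.prems(1-3)
  define slice where "slice f x = (\<integral>\<^sup>+s. f (x(j := s)) \<partial>lborel)"
    for f :: "('i \<Rightarrow> real) \<Rightarrow> ennreal" and x
  have fubini: "(\<integral>\<^sup>+x. f x \<partial>(\<Pi>\<^sub>M i\<in>insert j I. lborel)) = (\<integral>\<^sup>+x. slice f x \<partial>(\<Pi>\<^sub>M i\<in>I. lborel))"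
    if "f \<in> borel_measurable (\<Pi>\<^sub>M i\<in>insert j I. lborel)" for f
    unfolding slice_def using insert.hyps that by (intro product_nn_integral_insert) auto
  have meas_slice: "slice f \<in> borel_measurable (\<Pi>\<^sub>M i\<in>I. lborel)"
    if [measurable]: "f \<in> borel_measurable (\<Pi>\<^sub>M i\<in>insert j I. lborel)" for f
    unfolding slice_def by measurable
  have meas_upd: "(\<lambda>s. f (x(j := s))) \<in> borel_measurable borel"
    if x: "x \<in> extensional I" and f: "f \<in> borel_measurable (\<Pi>\<^sub>M i\<in>insert j I. lborel)" for f :: "('i \<Rightarrow> real) \<Rightarrow> ennreal" and x
  proof -
    have "x \<in> space (\<Pi>\<^sub>M i\<in>I. (lborel :: real measure))" using x by (simp add: space_PiM PiE_def)
    from measurable_comp[OF measurable_component_update f, OF this insert.hyps(2)]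
    show ?thesis by (simp add: comp_def fun_upd_def)
  qed
  have "(\<integral>\<^sup>+x. slice u x \<partial>(\<Pi>\<^sub>M i\<in>I. lborel)) * (\<integral>\<^sup>+x. slice v x \<partial>(\<Pi>\<^sub>M i\<in>I. lborel))
      \<le> (\<integral>\<^sup>+x. slice w x \<partial>(\<Pi>\<^sub>M i\<in>I. lborel))\<^sup>2"
  proof (intro insert.IH meas_slice insert.prems(1-3))
    fix x y :: "'i \<Rightarrow> real" assume xy: "x \<in> extensional I" "y \<in> extensional I"
    show "slice u x * slice v y \<le> (slice w (\<lambda>i\<in>I. (x i - y i) / 2))\<^sup>2"
      unfolding slice_def
    proof (intro Prekopa_Leindler_real meas_upd xy insert.prems(1-3))
      show "(\<lambda>i\<in>I. (x i - y i) / 2) \<in> extensional I" by simp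
    next
      fix s r :: real
      have "(\<lambda>i\<in>insert j I. ((x(j := s)) i - (y(j := r)) i) / 2) = (\<lambda>i\<in>I. (x i - y i) / 2)(j := (s - r) / 2)"
        using insert.hyps by (auto simp: fun_eq_iff)
      moreover have "x(j := s) \<in> extensional (insert j I)" "y(j := r) \<in> extensional (insert j I)"
        using xy by (auto simp: extensional_def)
      ultimately show "u (x(j := s)) * v (y(j := r)) \<le> (w ((\<lambda>i\<in>I. (x i - y i) / 2)(j := (s - r) / 2)))\<^sup>2"
        using insert.prems(4) by metis
    qed
  qed
  then show ?case by (simp add: fubini insert.prems)
qed


section \<open>Tail bounds from energy bounds\<close>

lemma powr_sum_le:
  fixes x y q :: real
  assumes "0 \<le> x" "0 \<le> y" "1 \<le> q"
  shows "x powr q + y powr q \<le> (x + y) powr q"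
proof (cases "x + y = 0")
  case False
  define s where "s = x + y"
  have s: "s > 0" using False assms by (simp add: s_def)
  have "z powr q \<le> z * s powr (q - 1)" if "0 \<le> z" "z \<le> s" for z
  proof (cases "z = 0")
    case False
    then have "z powr q = z * z powr (q - 1)" using that by (simp add: powr_diff)
    also have "\<dots> \<le> z * s powr (q - 1)" using that assms by (intro mult_left_mono powr_mono2) auto
    finally show ?thesis .
  qed simp
  from this[of x] this[of y] have "x powr q + y powr q \<le> (x + y) * s powr (q - 1)"
    using assms by (simp add: s_def distrib_right)
  also have "\<dots> = s powr q" using s by (simp add: s_def[symmetric] powr_diff)
  finally show ?thesis by (simp add: s_def)
qed (use assms in \<open>auto simp: add_nonneg_eq_0_iff\<close>)

text \<open>Put \<open>q = p / 2\<close>. Superadditivity of the power \<open>q\<close> bounds the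
  left side by a power of \<open>a\<^sup>2 + b\<^sup>2\<close>, which by the parallelogram identity
  is the mean of \<open>(a + b)\<^sup>2\<close> and \<open>(a - b)\<^sup>2\<close>; convexity
  finishes.\<close>

lemma Clarkson_powr:
  fixes a b p :: real
  assumes p: "p \<ge> 2"
  shows "2 * (\<bar>a\<bar> powr p + \<bar>b\<bar> powr p) \<le> \<bar>a + b\<bar> powr p + \<bar>a - b\<bar> powr p"
proof -
  define q where "q = p / 2"
  have q: "q \<ge> 1" using p by (simp add: q_def)
  have sq: "\<bar>x\<bar> powr p = (x\<^sup>2) powr q" for x :: real
  proof -
    have "(x\<^sup>2) powr q = (\<bar>x\<bar> powr 2) powr q" by simp
    then show ?thesis by (simp only: powr_powr) (simp add: q_def)
  qed
  have mid: "2 * ((x + y) / 2) powr q \<le> x powr q + y powr q" if "x \<ge> 0" "y \<ge> 0" for x y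
  proof (cases "x = 0 \<or> y = 0")
    case True
    \<comment> \<open>When one argument is zero, superadditivity at two equal halves replaces
      convexity.\<close>
    have "2 * (z / 2) powr q \<le> z powr q" if "z \<ge> 0" for z
      using powr_sum_le[of "z / 2" "z / 2" q] that q by simp
    then show ?thesis using True that q by auto
  next
    case False
    then show ?thesis
      using convex_onD[OF powr_convex[OF q], of "1 / 2" x y] that by (simp add: field_simps)
  qed
  have "(a\<^sup>2) powr q + (b\<^sup>2) powr q \<le> (a\<^sup>2 + b\<^sup>2) powr q"
    using q by (intro powr_sum_le) auto
  also have "a\<^sup>2 + b\<^sup>2 = ((a + b)\<^sup>2 + (a - b)\<^sup>2) / 2" by (simp add: power2_eq_square algebra_simps)
  finally show ?thesis using mid[of "(a + b)\<^sup>2" "(a - b)\<^sup>2"] unfolding sq by simp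
qed

section \<open>The surface measure in its free coordinates\<close>

definition zero_extension :: "'v set \<Rightarrow> 'v set \<Rightarrow> ('v \<Rightarrow> real) \<Rightarrow> 'v \<Rightarrow> real" where
  "zero_extension V V\<^sub>0 \<phi> = (\<lambda>v\<in>V. if v \<in> V\<^sub>0 then 0 else \<phi> v)"

lemma measurable_zero_extension [measurable]:
  "zero_extension V V\<^sub>0 \<in> measurable (\<Pi>\<^sub>M v\<in>V - V\<^sub>0. lborel) (\<Pi>\<^sub>M v\<in>V. borel)"
  unfolding zero_extension_def
proof (intro measurable_restrict)
  fix v assume "v \<in> V"
  show "(\<lambda>\<phi>. if v \<in> V\<^sub>0 then 0 else \<phi> v) \<in> borel_measurable (\<Pi>\<^sub>M v\<in>V - V\<^sub>0. lborel)"
  proof (cases "v \<in> V\<^sub>0")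
    case False
    with \<open>v \<in> V\<close> have "(\<lambda>\<phi>. \<phi> v) \<in> measurable (\<Pi>\<^sub>M v\<in>V - V\<^sub>0. lborel) lborel"
      by (intro measurable_component_singleton) auto
    with False show ?thesis by simp
  qed simp
qed

lemma zero_boundary_lebesgue_eq_distr:
  "zero_boundary_lebesgue V V\<^sub>0
    = distr (\<Pi>\<^sub>M v\<in>V - V\<^sub>0. lborel) (\<Pi>\<^sub>M v\<in>V. borel) (zero_extension V V\<^sub>0)"
  by (simp add: zero_boundary_lebesgue_def zero_extension_def[abs_def])

lemma partition_function_eq:
  assumes [measurable]: "surface_energy U E \<in> borel_measurable (\<Pi>\<^sub>M v\<in>V. borel)"
  shows "partition_function V E U V\<^sub>0
    = (\<integral>\<^sup>+\<phi>. ennreal (exp (- surface_energy U E (zero_extension V V\<^sub>0 \<phi>))) \<partial>(\<Pi>\<^sub>M v\<in>V - V\<^sub>0. lborel))"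
  unfolding partition_function_def zero_boundary_lebesgue_eq_distr by (simp add: nn_integral_distr)

lemma emeasure_random_surface_measure:
  assumes [measurable]: "surface_energy U E \<in> borel_measurable (\<Pi>\<^sub>M v\<in>V. borel)"
    "A \<in> sets (\<Pi>\<^sub>M v\<in>V. borel)"
  shows "emeasure (random_surface_measure V E U V\<^sub>0) A
    = (\<integral>\<^sup>+\<phi>. indicator A (zero_extension V V\<^sub>0 \<phi>) * ennreal (exp (- surface_energy U E (zero_extension V V\<^sub>0 \<phi>)))
        \<partial>(\<Pi>\<^sub>M v\<in>V - V\<^sub>0. lborel)) / partition_function V E U V\<^sub>0"
proof -
  note Leb = zero_boundary_lebesgue_eq_distr[of V V\<^sub>0]
  have "emeasure (random_surface_measure V E U V\<^sub>0) A
      = (\<integral>\<^sup>+\<phi>. ennreal (exp (- surface_energy U E \<phi>)) / partition_function V E U V\<^sub>0 * indicator A \<phi>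
          \<partial>zero_boundary_lebesgue V V\<^sub>0)"
    unfolding random_surface_measure_def by (subst emeasure_density) (simp_all add: Leb)
  also have "\<dots> = (\<integral>\<^sup>+\<phi>. (indicator A \<phi> * ennreal (exp (- surface_energy U E \<phi>))) / partition_function V E U V\<^sub>0
          \<partial>zero_boundary_lebesgue V V\<^sub>0)"
    by (intro nn_integral_cong) (simp add: divide_ennreal_def mult_ac)
  also have "\<dots> = (\<integral>\<^sup>+\<phi>. indicator A \<phi> * ennreal (exp (- surface_energy U E \<phi>)) \<partial>zero_boundary_lebesgue V V\<^sub>0)
      / partition_function V E U V\<^sub>0"
    by (subst nn_integral_divide) (simp_all add: Leb)
  finally show ?thesis
    by (simp add: Leb nn_integral_distr)
qed

lemma ennreal_power2_le_imp_le:
  fixes x y :: ennreal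
  assumes "x\<^sup>2 \<le> y\<^sup>2"
  shows "x \<le> y"
proof (rule ccontr)
  assume "\<not> x \<le> y"
  then have "y < x" by simp
  then obtain b where b: "y = ennreal b" "0 \<le> b" by (cases y) auto
  have "y * y < x * x"
  proof (cases x)
    case (real a)
    then have "b * b < a * a" using b \<open>y < x\<close> by (simp add: ennreal_less_iff mult_strict_mono')
    then show ?thesis using real b by (simp add: ennreal_mult[symmetric] ennreal_less_iff)
  next
    case top
    then show ?thesis using b by (simp add: ennreal_mult[symmetric] ennreal_mult_top)
  qed
  then show False using assms by (simp add: power2_eq_square)
qed

text \<open>Midpoints of two configurations in \<open>\<bar>\<phi> v\<bar> > t\<close> may cancel at
  \<open>v\<close>, but \<open>\<phi> v > t\<close> and \<open>\<phi> v < - t\<close> are each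
  closed under midpoints. Each is bounded separately, whence the factor 2.\<close>

lemma random_surface_tail:
  fixes U :: "real \<Rightarrow> real" and p t R :: real
  assumes p: "p \<ge> 2" and U: "U = (\<lambda>x. \<bar>x\<bar> powr p + x\<^sup>2)"
    and fin: "finite V" "finite E"
    and or: "is_orientation E \<omega>" and E: "\<And>e. e \<in> E \<Longrightarrow> e \<subseteq> V"
    and v: "v \<in> V"
    and energy: "\<And>h. (\<And>x. x \<in> V\<^sub>0 \<Longrightarrow> x \<in> V \<Longrightarrow> h x = 0) \<Longrightarrow> \<bar>h v\<bar> > t \<Longrightarrow> R \<le> surface_energy U E h"
  shows "\<P>(\<phi> in random_surface_measure V E U V\<^sub>0. \<bar>\<phi> v\<bar> > t) \<le> 2 * exp (- R)"
proof -
  let ?N = "\<Pi>\<^sub>M v\<in>V - V\<^sub>0. (lborel :: real measure)"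
  let ?M = "\<Pi>\<^sub>M v\<in>V. (borel :: real measure)"
  let ?\<mu> = "random_surface_measure V E U V\<^sub>0"
  let ?ext = "zero_extension V V\<^sub>0"
  have ends: "fst (\<omega> e) \<in> V" "snd (\<omega> e) \<in> V" if "e \<in> E" for e
    using or E[OF that] that unfolding is_orientation_def by blast+
  have even: "U (- x) = U x" for x by (simp add: U)
  have H: "surface_energy U E \<phi> = (\<Sum>e\<in>E. U (\<phi> (fst (\<omega> e)) - \<phi> (snd (\<omega> e))))" for \<phi>
    using surface_energy_orientation[OF or, of U, OF even] by (simp add: edge_gradient_def)
  have Umeas: "U \<in> borel_measurable borel" unfolding U by measurable
  have Hmeas[measurable]: "surface_energy U E \<in> borel_measurable ?M"
  proof -
    have "(\<lambda>\<phi>. \<Sum>e\<in>E. U (\<phi> (fst (\<omega> e)) - \<phi> (snd (\<omega> e)))) \<in> borel_measurable ?M"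
      using ends by (intro borel_measurable_sum measurable_compose[OF _ Umeas] borel_measurable_diff
          measurable_component_singleton)
    then show ?thesis by (subst H[abs_def])
  qed
  \<comment> \<open>The quadratic part gives equality; the power part is Clarkson at the half
    difference and half sum.\<close>
  have parallelogram: "2 * U ((a - b) / 2) + 2 * U ((a + b) / 2) \<le> U a + U b" for a b
  proof -
    have "2 * (((a - b) / 2)\<^sup>2 + ((a + b) / 2)\<^sup>2) = a\<^sup>2 + b\<^sup>2"
      by (simp add: power2_eq_square field_simps)
    then show ?thesis
      using Clarkson_powr[OF p, of "(a - b) / 2" "(a + b) / 2"]
      by (simp add: U field_simps)
  qed
  \<comment> \<open>For \<open>Z = 0\<close> and \<open>Z = \<top>\<close> this relies on the conventions \<open>0 / 0 = 0\<close> and \<open>\<top> / \<top> = 0\<close>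
    in \<open>ennreal\<close>.\<close>
  have half: "emeasure ?\<mu> A \<le> ennreal (exp (- R))"
    if [measurable]: "A \<in> sets ?M" and A: "\<And>\<phi> \<psi>. \<phi> \<in> A \<Longrightarrow> \<psi> \<in> A \<Longrightarrow> \<bar>(\<phi> v + \<psi> v) / 2\<bar> > t" for A
  proof -
    define f where "f \<phi> = ennreal (exp (- surface_energy U E (zero_extension V V\<^sub>0 \<phi>)))" for \<phi>
    define u where "u \<phi> = indicator A (?ext \<phi>) * f \<phi>" for \<phi>
    define w where "w \<phi> = ennreal (exp (- R)) * f \<phi>" for \<phi>
    have [measurable]: "f \<in> borel_measurable ?N" "u \<in> borel_measurable ?N" "w \<in> borel_measurable ?N"
      unfolding f_def u_def w_def by measurable
    have "(\<integral>\<^sup>+\<phi>. u \<phi> \<partial>?N) * (\<integral>\<^sup>+\<phi>. u \<phi> \<partial>?N) \<le> (\<integral>\<^sup>+\<phi>. w \<phi> \<partial>?N)\<^sup>2"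
    proof (rule Prekopa_Leindler_PiM)
      fix x y :: "'a \<Rightarrow> real"
      let ?d = "\<lambda>z\<in>V - V\<^sub>0. (x z - y z) / 2"
      show "u x * u y \<le> (w ?d)\<^sup>2"
      proof (cases "?ext x \<in> A \<and> ?ext y \<in> A")
        case True
        \<comment> \<open>The midpoint \<open>h\<close> pays the energy \<open>R\<close>, while the
          half difference \<open>?d\<close> is the argument of \<open>w\<close>.\<close>
        define h where "h z = (?ext x z + ?ext y z) / 2" for z
        have "R \<le> surface_energy U E h"
        proof (rule energy)
          show "h z = 0" if "z \<in> V\<^sub>0" "z \<in> V" for z using that by (simp add: h_def zero_extension_def)
          show "t < \<bar>h v\<bar>" using A True by (simp add: h_def)
        qed
        moreover have "2 * surface_energy U E (?ext ?d) + 2 * surface_energy U E h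
            \<le> surface_energy U E (?ext x) + surface_energy U E (?ext y)"
        proof -
          have "2 * U (?ext ?d (fst (\<omega> e)) - ?ext ?d (snd (\<omega> e))) + 2 * U (h (fst (\<omega> e)) - h (snd (\<omega> e)))
              \<le> U (?ext x (fst (\<omega> e)) - ?ext x (snd (\<omega> e))) + U (?ext y (fst (\<omega> e)) - ?ext y (snd (\<omega> e)))"
            if e: "e \<in> E" for e
          proof -
            have "?ext ?d z = (?ext x z - ?ext y z) / 2" if "z \<in> V" for z
              using that by (simp add: zero_extension_def)
            then have "?ext ?d (fst (\<omega> e)) - ?ext ?d (snd (\<omega> e))
                = ((?ext x (fst (\<omega> e)) - ?ext x (snd (\<omega> e))) - (?ext y (fst (\<omega> e)) - ?ext y (snd (\<omega> e)))) / 2"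
              using ends[OF e] by (simp add: field_simps)
            moreover have "h (fst (\<omega> e)) - h (snd (\<omega> e))
                = ((?ext x (fst (\<omega> e)) - ?ext x (snd (\<omega> e))) + (?ext y (fst (\<omega> e)) - ?ext y (snd (\<omega> e)))) / 2"
              by (simp add: h_def field_simps)
            ultimately show ?thesis using parallelogram by presburger
          qed
          then show ?thesis
            unfolding H sum_distrib_left sum.distrib[symmetric] by (intro sum_mono)
        qed
        ultimately have "exp (- surface_energy U E (?ext x)) * exp (- surface_energy U E (?ext y))
            \<le> (exp (- R) * exp (- surface_energy U E (?ext ?d)))\<^sup>2"
          by (simp add: power2_eq_square exp_add[symmetric])
        then show ?thesis
          using True by (simp add: u_def w_def f_def ennreal_mult[symmetric] ennreal_power)
      qed (auto simp: u_def)
    qed (use fin in simp_all)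
    then have "(\<integral>\<^sup>+\<phi>. u \<phi> \<partial>?N)\<^sup>2 \<le> (\<integral>\<^sup>+\<phi>. w \<phi> \<partial>?N)\<^sup>2"
      by (simp only: power2_eq_square)
    then have "(\<integral>\<^sup>+\<phi>. u \<phi> \<partial>?N) \<le> (\<integral>\<^sup>+\<phi>. w \<phi> \<partial>?N)"
      by (rule ennreal_power2_le_imp_le)
    also have "\<dots> = ennreal (exp (- R)) * partition_function V E U V\<^sub>0"
      using partition_function_eq[OF Hmeas, of V\<^sub>0]
      by (simp add: w_def nn_integral_cmult f_def)
    finally have "(\<integral>\<^sup>+\<phi>. u \<phi> \<partial>?N) / partition_function V E U V\<^sub>0
        \<le> ennreal (exp (- R)) * (partition_function V E U V\<^sub>0 / partition_function V E U V\<^sub>0)"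
      by (metis divide_right_mono_ennreal ennreal_times_divide)
    also have "\<dots> \<le> ennreal (exp (- R)) * 1"
    proof (intro mult_left_mono)
      show "partition_function V E U V\<^sub>0 / partition_function V E U V\<^sub>0 \<le> 1"
        by (cases "partition_function V E U V\<^sub>0 = 0"; cases "partition_function V E U V\<^sub>0 = \<top>")
          (auto simp: divide_ennreal_def ennreal_divide_self[unfolded divide_ennreal_def] less_top)
    qed simp
    finally show ?thesis
      using emeasure_random_surface_measure[OF Hmeas, of A V\<^sub>0]
      by (simp add: u_def f_def)
  qed
  have comp[measurable]: "(\<lambda>\<phi>. \<phi> v) \<in> borel_measurable ?M" using v by simp
  have sets: "sets ?\<mu> = sets ?M"
    by (simp add: random_surface_measure_def zero_boundary_lebesgue_def)
  then have space: "space ?\<mu> = space ?M" by (rule sets_eq_imp_space_eq)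
  let ?P = "{\<phi> \<in> space ?M. \<phi> v > t}" and ?Q = "{\<phi> \<in> space ?M. \<phi> v < - t}"
  have mPQ: "?P \<in> sets ?M" "?Q \<in> sets ?M" by measurable
  have "{\<phi> \<in> space ?\<mu>. \<bar>\<phi> v\<bar> > t} \<subseteq> ?P \<union> ?Q" by (auto simp: space)
  then have "emeasure ?\<mu> {\<phi> \<in> space ?\<mu>. \<bar>\<phi> v\<bar> > t} \<le> emeasure ?\<mu> (?P \<union> ?Q)"
    using mPQ sets by (intro emeasure_mono) auto
  also have "\<dots> \<le> emeasure ?\<mu> ?P + emeasure ?\<mu> ?Q"
    using mPQ sets by (intro emeasure_subadditive) auto
  also have "\<dots> \<le> ennreal (exp (- R)) + ennreal (exp (- R))"
  proof (intro add_mono half mPQ)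
    fix \<phi> \<psi> assume "\<phi> \<in> ?P" "\<psi> \<in> ?P"
    then have "(\<phi> v + \<psi> v) / 2 > t" by simp
    then show "\<bar>(\<phi> v + \<psi> v) / 2\<bar> > t" by linarith
  next
    fix \<phi> \<psi> assume "\<phi> \<in> ?Q" "\<psi> \<in> ?Q"
    then have "(\<phi> v + \<psi> v) / 2 < - t" by simp
    then show "\<bar>(\<phi> v + \<psi> v) / 2\<bar> > t" by linarith
  qed
  also have "\<dots> = ennreal (2 * exp (- R))" by (simp add: ennreal_plus[symmetric] del: ennreal_plus)
  finally show ?thesis
    unfolding measure_def by (intro enn2real_leI) auto
qed


section \<open>A variational problem on dyadic scales\<close>

definition tail_rate :: "nat \<Rightarrow> real \<Rightarrow> real \<Rightarrow> real" where
  "tail_rate d p t =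
     (if real d < p then t ^ d else if real d = p then t ^ d / (ln t) ^ (d - 1) else t powr p)"

lemma sum_power_le_twice_first:
  fixes r :: real
  assumes "0 \<le> r" "r \<le> 1 / 2"
  shows "(\<Sum>j\<in>{m..n}. r ^ j) \<le> 2 * r ^ m"
proof (cases "m \<le> n")
  case True
  have "(\<Sum>j\<in>{m..n}. r ^ j) \<ge> 0" using assms by (intro sum_nonneg) auto
  then have "1 / 2 * (\<Sum>j\<in>{m..n}. r ^ j) \<le> (1 - r) * (\<Sum>j\<in>{m..n}. r ^ j)"
    using assms by (intro mult_right_mono) auto
  also have "\<dots> = r ^ m - r ^ Suc n" using sum_gp_multiplied[OF True, of r] by simp
  also have "\<dots> \<le> r ^ m" using assms zero_le_power[of r "Suc n"] by linarith
  finally show ?thesis by simp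
qed (use assms in simp)

lemma exists_power2_between:
  fixes t :: real
  assumes "t \<ge> 1"
  obtains J :: nat where "2 ^ J \<le> t" "t < 2 ^ Suc J"
proof -
  obtain n where n: "t < 2 ^ n" using real_arch_pow[of 2 t] by auto
  define m where "m = (LEAST n. t < 2 ^ n)"
  have m: "t < 2 ^ m" unfolding m_def using n by (rule LeastI)
  then obtain J where J: "m = Suc J" using assms by (cases m) auto
  then have "\<not> t < 2 ^ J" using not_less_Least[of J "\<lambda>n. t < 2 ^ n"] by (auto simp: m_def[symmetric])
  with m J show ?thesis by (intro that[of J]) auto
qed

text \<open>The assumption \<open>small\<close> bounds by \<open>s / 2\<close> what gradients below
  the thresholds can contribute. Above the thresholds, one edge may count at many scales, but the
  weights \<open>a j\<close> decay geometrically, so its total weight is at most twice that at the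
  first such scale. The power term sets the threshold up to scale \<open>J\<close>, the quadratic
  term beyond it.\<close>

lemma threshold_bound:
  fixes G :: "'a \<Rightarrow> real" and Q :: "nat \<Rightarrow> 'a set" and d K J :: nat and p D lam s :: real
  defines "a \<equiv> \<lambda>j. (1 / 2) ^ (j * (d - 1)) :: real"
  assumes d: "d \<ge> 3" and p: "p > 2" and lam: "lam > 0" and D: "D \<ge> 0"
    and fin: "finite Z" and G: "\<And>e. e \<in> Z \<Longrightarrow> 0 \<le> G e"
    and Q: "\<And>j. j \<le> K \<Longrightarrow> Q j \<subseteq> Z" "\<And>j. j \<le> K \<Longrightarrow> real (card (Q j)) \<le> D * 2 ^ (j * d)"
    and small: "D * (lam powr (1 / (p - 1)) * (\<Sum>j\<le>J. (2 powr (1 - (real d - 1) / (p - 1))) ^ j)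
                  + 2 * (lam * (1 / 2) ^ ((d - 2) * Suc J))) \<le> s / 2"
    and s: "s \<le> (\<Sum>j\<le>K. a j * (\<Sum>e\<in>Q j. G e))"
  shows "lam * s / 4 \<le> (\<Sum>e\<in>Z. G e powr p + (G e)\<^sup>2)"
proof -
  define \<beta> where "\<beta> = 1 / (p - 1)"
  define y where "y j = (if j \<le> J then (lam * a j) powr \<beta> else lam * a j)" for j
  have a: "a j > 0" for j by (simp add: a_def)
  have a_geometric: "a j = ((1 / 2) ^ (d - 1)) ^ j" for j
    unfolding a_def by (subst mult.commute) (rule power_mult)
  have y: "y j \<ge> 0" for j using lam a[of j] by (auto simp: y_def)
  have finQ: "finite (Q j)" if "j \<le> K" for j using Q(1)[OF that] fin finite_subset by blast
  \<comment> \<open>Weight times the number of edges, \<open>a j * 2 ^ (j * d)\<close>, equals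
    \<open>2 ^ j\<close>; hence \<open>2 ^ j * y j\<close> is, up to \<open>D\<close>, the most that
    scale \<open>j\<close> gets from small gradients.\<close>
  have y_first: "2 ^ j * y j = lam powr \<beta> * (2 powr (1 - (real d - 1) / (p - 1))) ^ j" if "j \<le> J" for j
  proof -
    have "a j = inverse (2 ^ (j * (d - 1)))" by (simp add: a_def power_one_over inverse_eq_divide)
    also have "\<dots> = 2 powr (- real (j * (d - 1)))"
      by (simp only: powr_minus) (subst powr_realpow; simp)
    also have "real (j * (d - 1)) = real j * (real d - 1)" using d by simp
    finally have aj: "a j = 2 powr (- (real j * (real d - 1)))" .
    have "a j powr \<beta> = 2 powr (- (real j * (real d - 1)) * \<beta>)" unfolding aj by (rule powr_powr)
    moreover have "(2::real) ^ j = 2 powr real j" by (rule powr_realpow[symmetric]) simp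
    moreover have "(2 powr (1 - (real d - 1) / (p - 1))) ^ j = 2 powr ((1 - (real d - 1) / (p - 1)) * real j)"
      by (simp add: powr_powr[symmetric] powr_realpow)
    moreover have "(1 - (real d - 1) / (p - 1)) * real j = real j + - (real j * (real d - 1)) * \<beta>"
      by (simp add: \<beta>_def algebra_simps diff_divide_distrib)
    moreover have "y j = lam powr \<beta> * a j powr \<beta>"
      using that lam a[of j] by (simp add: y_def powr_mult)
    ultimately show ?thesis by (simp only: powr_add mult.left_commute)
  qed
  have y_last: "2 ^ j * y j = lam * ((1 / 2) ^ (d - 2)) ^ j" if "\<not> j \<le> J" for j
  proof -
    have "j * (d - 1) = j + (d - 2) * j" using d by (cases d) (auto simp: algebra_simps)
    then have "a j = (1 / 2) ^ j * ((1 / 2) ^ (d - 2)) ^ j"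
      unfolding a_def by (simp only: power_add power_mult)
    then have "2 ^ j * a j = (2 * (1 / 2)) ^ j * ((1 / 2) ^ (d - 2)) ^ j"
      by (simp only: power_mult_distrib mult.assoc)
    then have "2 ^ j * a j = ((1 / 2) ^ (d - 2)) ^ j" by simp
    then show ?thesis using that by (simp add: y_def)
  qed
  \<comment> \<open>This is where \<open>d \<ge> 3\<close> makes the sum over large scales
    converge.\<close>
  have r: "(1 / 2 :: real) ^ (d - 2) \<le> 1 / 2"
    using d power_decreasing[of 1 "d - 2" "1 / 2 :: real"] by simp
  have sum_y: "(\<Sum>j\<le>K. 2 ^ j * y j)
      \<le> lam powr \<beta> * (\<Sum>j\<le>J. (2 powr (1 - (real d - 1) / (p - 1))) ^ j)
        + 2 * (lam * (1 / 2) ^ ((d - 2) * Suc J))"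
  proof -
    \<comment> \<open>An inequality, since for \<open>K < J\<close> the right side has additional
      nonnegative terms.\<close>
    have "(\<Sum>j\<le>K. 2 ^ j * y j) \<le> (\<Sum>j\<in>{..J} \<union> {Suc J..K}. 2 ^ j * y j)"
      using y by (intro sum_mono2) auto
    also have "\<dots> = (\<Sum>j\<le>J. 2 ^ j * y j) + (\<Sum>j\<in>{Suc J..K}. 2 ^ j * y j)"
      by (intro sum.union_disjoint) auto
    also have "\<dots> = lam powr \<beta> * (\<Sum>j\<le>J. (2 powr (1 - (real d - 1) / (p - 1))) ^ j)
        + lam * (\<Sum>j\<in>{Suc J..K}. ((1 / 2) ^ (d - 2)) ^ j)"
      using y_first y_last by (simp add: sum_distrib_left)
    also have "\<dots> \<le> lam powr \<beta> * (\<Sum>j\<le>J. (2 powr (1 - (real d - 1) / (p - 1))) ^ j)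
        + lam * (2 * ((1 / 2) ^ (d - 2)) ^ Suc J)"
      using lam r by (intro add_left_mono mult_left_mono sum_power_le_twice_first) auto
    finally show ?thesis by (simp only: power_mult mult.left_commute[of 2 lam])
  qed
  define Small where "Small j = {e \<in> Q j. G e \<le> y j}" for j
  define Large where "Large j = {e \<in> Q j. y j < G e}" for j
  have "(\<Sum>j\<le>K. a j * (\<Sum>e\<in>Small j. G e)) \<le> (\<Sum>j\<le>K. D * (2 ^ j * y j))"
  proof (intro sum_mono)
    fix j assume "j \<in> {..K}"
    then have j: "j \<le> K" by simp
    have "(\<Sum>e\<in>Small j. G e) \<le> real (card (Small j)) * y j"
      by (intro sum_bounded_above) (auto simp: Small_def)
    also have "\<dots> \<le> real (card (Q j)) * y j"
      using finQ[OF j] y by (intro mult_right_mono) (auto simp: Small_def intro!: card_mono)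
    also have "\<dots> \<le> D * 2 ^ (j * d) * y j" using Q(2)[OF j] y by (intro mult_right_mono) auto
    finally have "a j * (\<Sum>e\<in>Small j. G e) \<le> a j * (D * 2 ^ (j * d) * y j)"
      using a[of j] by (intro mult_left_mono) auto
    also have "a j * (D * 2 ^ (j * d) * y j) = D * (2 ^ j * y j)"
    proof -
      have "j * d = j * (d - 1) + j" using d by (cases d) auto
      then have "a j * 2 ^ (j * d) = 2 ^ j" by (simp add: a_def power_add power_one_over)
      then show ?thesis by (simp add: mult_ac)
    qed
    finally show "a j * (\<Sum>e\<in>Small j. G e) \<le> D * (2 ^ j * y j)" .
  qed
  also have "\<dots> \<le> s / 2"
    using mult_left_mono[OF sum_y D] small by (simp add: sum_distrib_left \<beta>_def)
  finally have small_part: "(\<Sum>j\<le>K. a j * (\<Sum>e\<in>Small j. G e)) \<le> s / 2" .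
  have "(\<Sum>j\<le>K. a j * (\<Sum>e\<in>Q j. G e))
      = (\<Sum>j\<le>K. a j * (\<Sum>e\<in>Small j. G e)) + (\<Sum>j\<le>K. a j * (\<Sum>e\<in>Large j. G e))"
  proof -
    have "(\<Sum>e\<in>Q j. G e) = (\<Sum>e\<in>Small j. G e) + (\<Sum>e\<in>Large j. G e)" if "j \<le> K" for j
    proof -
      have "Q j = Small j \<union> Large j" by (auto simp: Small_def Large_def)
      then show ?thesis
        using finQ[OF that] by (subst sum.union_disjoint[symmetric]) (auto simp: Small_def Large_def)
    qed
    then show ?thesis by (simp add: sum.distrib[symmetric] distrib_left)
  qed
  with small_part s have large_part: "s / 2 \<le> (\<Sum>j\<le>K. a j * (\<Sum>e\<in>Large j. G e))" by linarith
  \<comment> \<open>Exchanging the sums over scales and edges attaches to each edge the weights of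
    the scales in \<open>F e\<close>.\<close>
  define F where "F e = {j. j \<le> K \<and> e \<in> Large j}" for e
  have "(\<Sum>j\<le>K. a j * (\<Sum>e\<in>Large j. G e)) = (\<Sum>j\<le>K. \<Sum>e\<in>Z. if e \<in> Large j then a j * G e else 0)"
  proof (intro sum.cong refl)
    fix j assume "j \<in> {..K}"
    then have "Large j = {e \<in> Z. e \<in> Large j}" using Q(1)[of j] by (auto simp: Large_def)
    then show "a j * (\<Sum>e\<in>Large j. G e) = (\<Sum>e\<in>Z. if e \<in> Large j then a j * G e else 0)"
      using fin by (simp add: sum_distrib_left sum.inter_filter[symmetric])
  qed
  also have "\<dots> = (\<Sum>e\<in>Z. \<Sum>j\<le>K. if e \<in> Large j then a j * G e else 0)" by (rule sum.swap)
  also have "\<dots> = (\<Sum>e\<in>Z. (\<Sum>j\<in>F e. a j) * G e)"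
    by (intro sum.cong refl) (simp add: sum_distrib_right sum.inter_filter[symmetric] F_def)
  finally have swap: "(\<Sum>j\<le>K. a j * (\<Sum>e\<in>Large j. G e)) = (\<Sum>e\<in>Z. (\<Sum>j\<in>F e. a j) * G e)" .
  have edge: "lam * ((\<Sum>j\<in>F e. a j) * G e) \<le> 2 * (G e powr p + (G e)\<^sup>2)" if e: "e \<in> Z" for e
  proof (cases "F e = {}")
    case False
    define i where "i = Min (F e)"
    have finF: "finite (F e)" by (simp add: F_def)
    have i: "i \<in> F e" unfolding i_def using finF False by (rule Min_in)
    then have Gi: "y i < G e" by (simp add: F_def Large_def)
    have "(\<Sum>j\<in>F e. a j) \<le> (\<Sum>j\<in>{i..K}. a j)"
      using finF a by (intro sum_mono2) (auto simp: i_def F_def less_imp_le)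
    also have "\<dots> = (\<Sum>j\<in>{i..K}. ((1 / 2) ^ (d - 1)) ^ j)"
      by (simp only: a_geometric)
    also have "\<dots> \<le> 2 * ((1 / 2) ^ (d - 1)) ^ i"
      using d power_decreasing[of 1 "d - 1" "1 / 2 :: real"] by (intro sum_power_le_twice_first) auto
    also have "\<dots> = 2 * a i" by (simp only: a_geometric)
    finally have sum_F: "(\<Sum>j\<in>F e. a j) \<le> 2 * a i" .
    \<comment> \<open>Exceeding \<open>y i\<close> means
      \<open>lam * a i \<le> G e powr (p - 1)\<close> at small scales and
      \<open>lam * a i \<le> G e\<close> at large ones; one factor \<open>G e\<close> completes
      either term of the potential.\<close>
    have *: "lam * a i * G e \<le> G e powr p + (G e)\<^sup>2"
    proof (cases "i \<le> J")
      case True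
      have "lam * a i = ((lam * a i) powr \<beta>) powr (p - 1)"
        using lam a[of i] p by (simp add: powr_powr \<beta>_def)
      also have "\<dots> \<le> G e powr (p - 1)"
        using Gi True p by (intro powr_mono2) (auto simp: y_def)
      finally have "lam * a i * G e \<le> G e powr (p - 1) * G e"
        using G[OF e] by (intro mult_right_mono)
      also have "\<dots> = G e powr p"
        using Gi y[of i] by (simp add: powr_diff)
      finally show ?thesis by (simp add: add_increasing2)
    next
      case False
      then have "lam * a i * G e \<le> G e * G e"
        using Gi G[OF e] by (intro mult_right_mono) (auto simp: y_def)
      then show ?thesis by (simp add: power2_eq_square add_increasing)
    qed
    have "lam * ((\<Sum>j\<in>F e. a j) * G e) \<le> lam * (2 * a i * G e)"
      using sum_F lam G[OF e] by (intro mult_left_mono mult_right_mono) auto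
    also have "\<dots> = 2 * (lam * a i * G e)" by simp
    also have "\<dots> \<le> 2 * (G e powr p + (G e)\<^sup>2)"
      using * by (rule mult_left_mono) simp
    finally show ?thesis .
  qed simp
  have "lam * (s / 2) \<le> lam * (\<Sum>e\<in>Z. (\<Sum>j\<in>F e. a j) * G e)"
    using large_part swap lam by (intro mult_left_mono) auto
  also have "\<dots> \<le> (\<Sum>e\<in>Z. 2 * (G e powr p + (G e)\<^sup>2))"
    using edge by (simp add: sum_distrib_left[of lam] sum_mono)
  also have "\<dots> = 2 * (\<Sum>e\<in>Z. G e powr p + (G e)\<^sup>2)" by (rule sum_distrib_left[symmetric])
  finally show ?thesis by simp
qed

section \<open>The tail rate in the three regimes\<close>

lemma tail_rate_pos: "t > 2 \<Longrightarrow> tail_rate d p t > 0"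
  by (auto simp: tail_rate_def)

lemma sum_power_le_of_gt_1:
  fixes b :: real
  assumes "b > 1"
  shows "(\<Sum>j\<le>J. b ^ j) \<le> b / (b - 1) * b ^ J"
proof -
  have "(\<Sum>j\<le>J. b ^ j) = (b ^ Suc J - 1) / (b - 1)"
    using assms geometric_sum[of b "Suc J"] by (simp add: lessThan_Suc_atMost)
  also have "\<dots> \<le> b ^ Suc J / (b - 1)" using assms by (intro divide_right_mono) auto
  finally show ?thesis by simp
qed

lemma sum_power_le_of_lt_1:
  fixes b :: real
  assumes "0 \<le> b" "b < 1"
  shows "(\<Sum>j\<le>J. b ^ j) \<le> 1 / (1 - b)"
proof -
  have "(\<Sum>j\<le>J. b ^ j) = (1 - b ^ Suc J) / (1 - b)"
    using assms geometric_sum[of b "Suc J"] by (simp add: lessThan_Suc_atMost divide_simps) (simp add: algebra_simps)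
  also have "\<dots> \<le> 1 / (1 - b)" using assms by (intro divide_right_mono) auto
  finally show ?thesis .
qed

text \<open>The ratio is above, equal to or below 1 according to whether \<open>d < p\<close>,
  \<open>d = p\<close> or \<open>d > p\<close>. The sum is then of the order of its last term, of
  the number of scales, or of a constant, and \<open>tail_rate\<close> compensates each case to give
  a multiple of \<open>t\<close>.\<close>

lemma tail_rate_geometric_sum:
  assumes d: "d \<ge> 3" and p: "p > 2"
  shows "\<exists>C>0. \<forall>t>2. \<forall>J. 2 ^ J \<le> t \<longrightarrow>
    (tail_rate d p t / t) powr (1 / (p - 1)) * (\<Sum>j\<le>J. (2 powr (1 - (real d - 1) / (p - 1))) ^ j) \<le> C * t"
proof -
  define \<alpha> where "\<alpha> = 1 - (real d - 1) / (p - 1)"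
  define b where "b = 2 powr \<alpha>"
  have b: "b > 0" by (simp add: b_def)
  consider "real d < p" | "real d = p" | "real d > p" by linarith
  then show ?thesis
  proof cases
    case 1
    then have "\<alpha> > 0" using p by (simp add: \<alpha>_def)
    then have b1: "b > 1" by (simp add: b_def)
    have "(tail_rate d p t / t) powr (1 / (p - 1)) * (\<Sum>j\<le>J. b ^ j) \<le> b / (b - 1) * t"
      if t: "t > 2" and J: "2 ^ J \<le> t" for t J
    proof -
      have "tail_rate d p t / t = t powr (real d - 1)"
        using 1 t by (simp add: tail_rate_def powr_diff powr_realpow)
      then have rate: "(tail_rate d p t / t) powr (1 / (p - 1)) = t powr (1 - \<alpha>)"
        by (simp add: powr_powr \<alpha>_def)
      have "b ^ J = (2 ^ J) powr \<alpha>"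
        by (simp add: b_def powr_realpow[symmetric] powr_powr mult.commute)
      also have "\<dots> \<le> t powr \<alpha>" using J \<open>\<alpha> > 0\<close> by (intro powr_mono2) auto
      finally have "(\<Sum>j\<le>J. b ^ j) \<le> b / (b - 1) * t powr \<alpha>"
        using sum_power_le_of_gt_1[OF b1, of J] b1
        by (meson divide_nonneg_nonneg less_eq_real_def diff_ge_0_iff_ge mult_left_mono order_trans zero_le_one)
      then have "t powr (1 - \<alpha>) * (\<Sum>j\<le>J. b ^ j) \<le> t powr (1 - \<alpha>) * (b / (b - 1) * t powr \<alpha>)"
        by (intro mult_left_mono) auto
      also have "\<dots> = b / (b - 1) * (t powr (1 - \<alpha>) * t powr \<alpha>)" by simp
      also have "t powr (1 - \<alpha>) * t powr \<alpha> = t" using t by (simp add: powr_add[symmetric])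
      finally show ?thesis using rate by simp
    qed
    then show ?thesis using b1 unfolding b_def \<alpha>_def by (intro exI[of _ "b / (b - 1)"]) (auto simp: b_def \<alpha>_def)
  next
    case 2
    then have "b = 1" using p by (simp add: b_def \<alpha>_def)
    have "(tail_rate d p t / t) powr (1 / (p - 1)) * (\<Sum>j\<le>J. b ^ j) \<le> 2 / ln 2 * t"
      if t: "t > 2" and J: "2 ^ J \<le> t" for t J
    proof -
      have l2: "ln t > ln 2" using t by simp
      then have l: "ln t > 0" by (meson ln_gt_zero less_trans one_less_numeral_iff semiring_norm(76))
      have "t ^ d = t ^ (d - 1) * t" using d by (cases d) auto
      then have "tail_rate d p t / t = (t / ln t) ^ (d - 1)"
        using 2 t by (simp add: tail_rate_def power_divide)
      also have "\<dots> = (t / ln t) powr (p - 1)"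
        using t l 2 d by (simp add: powr_realpow[symmetric])
      finally have "(tail_rate d p t / t) powr (1 / (p - 1)) = t / ln t"
        using p t l by (simp add: powr_powr)
      moreover have "(\<Sum>j\<le>J. b ^ j) = real J + 1" using \<open>b = 1\<close> by simp
      \<comment> \<open>There are \<open>J + 1\<close> scales up to \<open>t\<close>; this logarithm
        cancels the one in \<open>t / ln t\<close>. The additional 1 is absorbed because
        \<open>t > 2\<close>.\<close>
      moreover have "real J + 1 \<le> 2 / ln 2 * ln t"
      proof -
        have "real J * ln 2 = ln (2 ^ J)" by (simp add: ln_realpow)
        also have "\<dots> \<le> ln t" using J t by (intro ln_mono) auto
        finally have "(real J + 1) * ln 2 \<le> 2 * ln t" using l2 by (simp add: algebra_simps)
        then show ?thesis by (simp add: field_simps)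
      qed
      moreover have "t / ln t * (real J + 1) \<le> t / ln t * (2 / ln 2 * ln t)"
        using calculation(3) t l by (intro mult_left_mono) auto
      ultimately show ?thesis using l by (simp add: mult_ac)
    qed
    then show ?thesis unfolding b_def \<alpha>_def by (intro exI[of _ "2 / ln 2"]) (auto simp: b_def \<alpha>_def)
  next
    case 3
    then have "\<alpha> < 0" using p by (simp add: \<alpha>_def)
    then have b1: "b < 1" using powr_less_mono[of \<alpha> 0 2] by (simp add: b_def)
    have "(tail_rate d p t / t) powr (1 / (p - 1)) * (\<Sum>j\<le>J. b ^ j) \<le> 1 / (1 - b) * t"
      if t: "t > 2" for t J
    proof -
      have "tail_rate d p t / t = t powr (p - 1)"
        using 3 t by (simp add: tail_rate_def powr_diff)
      then have "(tail_rate d p t / t) powr (1 / (p - 1)) = t"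
        using p t by (simp add: powr_powr)
      then show ?thesis using sum_power_le_of_lt_1[of b J] b b1 t
        by (metis less_eq_real_def less_trans mult.commute mult_left_mono zero_less_numeral)
    qed
    then show ?thesis using b1 unfolding b_def \<alpha>_def by (intro exI[of _ "1 / (1 - b)"]) (auto simp: b_def \<alpha>_def)
  qed
qed

text \<open>Needed at scales beyond \<open>t\<close>: there the quadratic thresholds contribute a
  multiple of \<open>(tail_rate d p t / t) * t powr (2 - d)\<close>, which must be at most of order
  \<open>t\<close>.\<close>

lemma tail_rate_upper:
  assumes d: "d \<ge> 3" and p: "p > 2"
  shows "\<exists>C>0. \<forall>t>2. tail_rate d p t \<le> C * t ^ d"
proof (intro exI conjI allI impI)
  show "1 + 1 / (ln 2) ^ (d - 1) > (0 :: real)" by (intro add_pos_pos) auto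
  fix t :: real assume t: "t > 2"
  have "t ^ d / (ln t) ^ (d - 1) \<le> t ^ d / (ln 2) ^ (d - 1)"
    using t by (intro divide_left_mono power_mono) auto
  moreover have "t powr p \<le> t ^ d" if "p < real d"
    using t that powr_mono[of p "real d" t] by (simp add: powr_realpow)
  ultimately show "tail_rate d p t \<le> (1 + 1 / (ln 2) ^ (d - 1)) * t ^ d"
    using t by (auto simp: tail_rate_def algebra_simps intro: add_increasing add_increasing2)
qed

text \<open>In the application \<open>G\<close> is \<open>\<bar>\<nabla>h\<bar>\<close> on directed edges and \<open>Q j\<close> is the set of edges in a cube of side \<open>2^j\<close>.\<close>

lemma energy_lower_bound:
  fixes \<kappa> D p :: real and d :: nat
  assumes d: "d \<ge> 3" and p: "p > 2" and pos: "\<kappa> > 0" "D > 0"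
  shows "\<exists>c>0. \<forall>t>2. \<forall>K (Z :: 'a set) G Q.
    finite Z \<longrightarrow> (\<forall>e\<in>Z. 0 \<le> G e) \<longrightarrow>
    (\<forall>j\<le>K. Q j \<subseteq> Z \<and> real (card (Q j)) \<le> D * 2 ^ (j * d)) \<longrightarrow>
    \<kappa> * t \<le> (\<Sum>j\<le>K. (1 / 2) ^ (j * (d - 1)) * (\<Sum>e\<in>Q j. G e)) \<longrightarrow>
    c * tail_rate d p t \<le> (\<Sum>e\<in>Z. G e powr p + (G e)\<^sup>2)"
proof -
  obtain C1 where C1: "C1 > 0" and first: "\<And>t J. t > 2 \<Longrightarrow> 2 ^ J \<le> t \<Longrightarrow>
    (tail_rate d p t / t) powr (1 / (p - 1)) * (\<Sum>j\<le>J. (2 powr (1 - (real d - 1) / (p - 1))) ^ j) \<le> C1 * t"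
    using tail_rate_geometric_sum[OF d p] by blast
  obtain C2 where C2: "C2 > 0" and upper: "\<And>t. t > 2 \<Longrightarrow> tail_rate d p t \<le> C2 * t ^ d"
    using tail_rate_upper[OF d p] by blast
  define C where "C = max C1 C2"
  \<comment> \<open>With both threshold sums at most \<open>x * C * t\<close>, the total small part
    is \<open>3 * D * x * C * t = \<kappa> * t / 2\<close>, half of the available sum.\<close>
  define x where "x = \<kappa> / (6 * D * C)"
  have C: "C > 0" "C1 \<le> C" "C2 \<le> C" using C1 by (auto simp: C_def)
  then have x: "x > 0" using pos by (simp add: x_def)
  \<comment> \<open>The factor \<open>c\<close> enters the quadratic thresholds linearly and the
    power thresholds with exponent \<open>1 / (p - 1)\<close>; both must stay below
    \<open>x\<close>.\<close>
  define c where "c = min (x powr (p - 1)) x"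
  have c: "c > 0" "c \<le> x" "c powr (1 / (p - 1)) \<le> x"
  proof -
    show "c > 0" "c \<le> x" using x by (auto simp: c_def)
    have "c powr (1 / (p - 1)) \<le> (x powr (p - 1)) powr (1 / (p - 1))"
      using p \<open>c > 0\<close> by (intro powr_mono2) (auto simp: c_def)
    then show "c powr (1 / (p - 1)) \<le> x" using p x by (simp add: powr_powr)
  qed
  have main: "c * \<kappa> / 4 * tail_rate d p t \<le> (\<Sum>e\<in>Z. G e powr p + (G e)\<^sup>2)"
    if t: "t > 2" and fin: "finite Z" and G: "\<forall>e\<in>Z. 0 \<le> G e"
      and Q: "\<forall>j\<le>K. Q j \<subseteq> Z \<and> real (card (Q j)) \<le> D * 2 ^ (j * d)"
      and s: "\<kappa> * t \<le> (\<Sum>j\<le>K. (1 / 2) ^ (j * (d - 1)) * (\<Sum>e\<in>Q j. G e))"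
    for t K and Z :: "'a set" and G Q
  proof -
    \<comment> \<open>The changeover between power and quadratic thresholds is put at length scale
      \<open>t\<close>; below, \<open>lam\<close> is \<open>c * r\<close>.\<close>
    obtain J where J: "2 ^ J \<le> t" "t < 2 ^ Suc J" using exists_power2_between[of t] t by auto
    define r where "r = tail_rate d p t / t"
    have r: "r > 0" using tail_rate_pos[OF t, of d p] t by (simp add: r_def)
    have last: "r * (1 / 2) ^ ((d - 2) * Suc J) \<le> C2 * t"
    proof -
      have "d = Suc (Suc (d - 2))" using d by simp
      then have "t ^ d = t ^ Suc (Suc (d - 2))" by (rule arg_cong)
      then have "t ^ d = t ^ (d - 2) * t * t" by (simp only: power_Suc2)
      then have "r \<le> C2 * (t ^ (d - 2) * t)"
        using upper[OF t] t by (simp add: r_def field_simps)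
      moreover have "(1 / 2) ^ ((d - 2) * Suc J) \<le> 1 / t ^ (d - 2)"
      proof -
        have "t ^ (d - 2) \<le> (2 ^ Suc J) ^ (d - 2)" using J t by (intro power_mono) auto
        then have "1 / (2 ^ Suc J) ^ (d - 2) \<le> 1 / t ^ (d - 2)" using t by (intro divide_left_mono) auto
        also have "(2 ^ Suc J) ^ (d - 2) = (2 :: real) ^ ((d - 2) * Suc J)"
          by (simp only: power_mult[symmetric] mult.commute)
        finally show ?thesis by (simp only: power_one_over)
      qed
      ultimately have "r * (1 / 2) ^ ((d - 2) * Suc J) \<le> C2 * (t ^ (d - 2) * t) * (1 / t ^ (d - 2))"
        using r C2 t by (intro mult_mono) auto
      then show ?thesis using t by simp
    qed
    have "D * ((c * r) powr (1 / (p - 1)) * (\<Sum>j\<le>J. (2 powr (1 - (real d - 1) / (p - 1))) ^ j)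
                  + 2 * (c * r * (1 / 2) ^ ((d - 2) * Suc J))) \<le> D * (x * (C * t) + 2 * (x * (C * t)))"
    proof (intro mult_left_mono add_mono)
      have "(c * r) powr (1 / (p - 1)) * (\<Sum>j\<le>J. (2 powr (1 - (real d - 1) / (p - 1))) ^ j)
          = c powr (1 / (p - 1)) * (r powr (1 / (p - 1)) * (\<Sum>j\<le>J. (2 powr (1 - (real d - 1) / (p - 1))) ^ j))"
        using c r by (simp add: powr_mult)
      also have "\<dots> \<le> x * (C1 * t)"
        using first[OF t J(1)] c x by (rule_tac mult_mono) (auto simp: r_def intro!: mult_nonneg_nonneg sum_nonneg)
      also have "\<dots> \<le> x * (C * t)" using C x t by (intro mult_left_mono mult_right_mono) auto
      finally show "(c * r) powr (1 / (p - 1)) * (\<Sum>j\<le>J. (2 powr (1 - (real d - 1) / (p - 1))) ^ j) \<le> x * (C * t)" .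
      have "c * r * (1 / 2) ^ ((d - 2) * Suc J) = c * (r * (1 / 2) ^ ((d - 2) * Suc J))" by simp
      also have "\<dots> \<le> x * (C2 * t)" using last c x r by (rule_tac mult_mono) auto
      also have "\<dots> \<le> x * (C * t)" using C x t by (intro mult_left_mono mult_right_mono) auto
      finally show "c * r * (1 / 2) ^ ((d - 2) * Suc J) \<le> x * (C * t)" .
    qed (use pos in auto)
    also have "\<dots> = \<kappa> * t / 2" using pos C by (simp add: x_def field_simps)
    finally have "c * r * (\<kappa> * t) / 4 \<le> (\<Sum>e\<in>Z. G e powr p + (G e)\<^sup>2)"
      using d p c r pos fin G Q s by (intro threshold_bound[where J = J and D = D and K = K and Q = Q]) auto
    then show ?thesis using t by (simp add: r_def mult_ac)
  qed
  have "c * \<kappa> / 4 > 0" using c pos by simp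
  with main show ?thesis by blast
qed


section \<open>Averages over dyadic cubes\<close>

text \<open>Displacements are 0, not \<open>undefined\<close>, from coordinate \<open>d\<close> on,
  so \<open>shift\<close> leaves those coordinates of the base point unchanged.\<close>

definition cube :: "nat \<Rightarrow> nat \<Rightarrow> (nat \<Rightarrow> int) set" where
  "cube d M = PiE_dflt {..<d} 0 (\<lambda>_. {0..<int M})"

definition shift :: "(nat \<Rightarrow> int) \<Rightarrow> (nat \<Rightarrow> int) \<Rightarrow> nat \<Rightarrow> int" where
  "shift u y = (\<lambda>i. u i + y i)"

definition grad :: "((nat \<Rightarrow> int) \<Rightarrow> real) \<Rightarrow> nat \<Rightarrow> (nat \<Rightarrow> int) \<Rightarrow> real" where
  "grad g i x = \<bar>g (x(i := x i + 1)) - g x\<bar>"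

definition cube_sum :: "nat \<Rightarrow> ((nat \<Rightarrow> int) \<Rightarrow> real) \<Rightarrow> nat \<Rightarrow> (nat \<Rightarrow> int) \<Rightarrow> real" where
  "cube_sum d g M u = (\<Sum>y\<in>cube d M. g (shift u y))"

definition grad_sum :: "nat \<Rightarrow> ((nat \<Rightarrow> int) \<Rightarrow> real) \<Rightarrow> nat \<Rightarrow> (nat \<Rightarrow> int) \<Rightarrow> real" where
  "grad_sum d g M u = (\<Sum>i<d. cube_sum d (grad g i) M u)"

lemma mem_cube: "y \<in> cube d M \<longleftrightarrow> (\<forall>i<d. 0 \<le> y i \<and> y i < int M) \<and> (\<forall>i\<ge>d. y i = 0)"
  by (auto simp: cube_def PiE_dflt_def not_less)

lemma finite_cube [simp]: "finite (cube d M)"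
  by (auto simp: cube_def)

lemma card_cube: "card (cube d M) = M ^ d"
  by (simp add: cube_def card_PiE_dflt)

lemma inj_shift: "inj_on (shift u) A"
  by (auto simp: inj_on_def shift_def fun_eq_iff)

lemma grad_nonneg: "grad g i x \<ge> 0"
  by (simp add: grad_def)

lemma shift_cube_subset:
  assumes "\<forall>i<d. b i \<le> u i \<and> u i + int M \<le> b i + int N" "\<forall>i\<ge>d. u i = b i"
  shows "shift u ` cube d M \<subseteq> shift b ` cube d N"
proof clarify
  fix y assume y: "y \<in> cube d M"
  have "shift u y = shift b (\<lambda>i. u i - b i + y i)" by (simp add: shift_def)
  moreover have "(\<lambda>i. u i - b i + y i) \<in> cube d N"
    using y assms by (fastforce simp: mem_cube)
  ultimately show "shift u y \<in> shift b ` cube d N" by blast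
qed

lemma cube_sum_mono:
  assumes "\<And>x. f x \<ge> 0" "\<forall>i<d. b i \<le> u i \<and> u i + int M \<le> b i + int N" "\<forall>i\<ge>d. u i = b i"
  shows "cube_sum d f M u \<le> cube_sum d f N b"
proof -
  have "sum f (shift u ` cube d M) \<le> sum f (shift b ` cube d N)"
    using assms(1) shift_cube_subset[OF assms(2,3)] by (intro sum_mono2) auto
  then show ?thesis by (simp add: cube_sum_def sum.reindex[OF inj_shift])
qed

lemma cube_sum_step:
  "\<bar>cube_sum d g M (u(i := u i + int n)) - cube_sum d g M u\<bar>
    \<le> (\<Sum>s<n. cube_sum d (grad g i) M (u(i := u i + int s)))"
proof (induction n)
  case (Suc n)
  have "\<bar>cube_sum d g M (u(i := u i + int (Suc n))) - cube_sum d g M (u(i := u i + int n))\<bar>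
      \<le> cube_sum d (grad g i) M (u(i := u i + int n))"
  proof -
    have "(shift (u(i := u i + int (Suc n))) y) = (shift (u(i := u i + int n)) y)(i := shift (u(i := u i + int n)) y i + 1)" for y
      by (auto simp: shift_def fun_eq_iff)
    then show ?thesis
      unfolding cube_sum_def sum_subtractf[symmetric] by (auto simp: grad_def intro!: order_trans[OF sum_abs])
  qed
  with Suc.IH show ?case unfolding sum.lessThan_Suc by linarith
qed simp

text \<open>All intermediate translates of the cube lie in the large cube at \<open>b\<close>, so
  each unit step of the telescoping sum costs at most the gradient sum there.\<close>

lemma cube_sum_coordinate:
  assumes "i < d" "n \<le> m"
    and "\<forall>j<d. b j \<le> u j \<and> u j + int M \<le> b j + int N"
    and "u i + int n + int M \<le> b i + int N" "\<forall>j\<ge>d. u j = b j"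
  shows "\<bar>cube_sum d g M (u(i := u i + int n)) - cube_sum d g M u\<bar> \<le> real m * cube_sum d (grad g i) N b"
proof -
  have pos: "0 \<le> cube_sum d (grad g i) N b"
    by (auto simp: cube_sum_def grad_nonneg intro!: sum_nonneg)
  have "(\<Sum>s<n. cube_sum d (grad g i) M (u(i := u i + int s))) \<le> (\<Sum>s<n. cube_sum d (grad g i) N b)"
  proof (intro sum_mono cube_sum_mono)
    fix s assume "s \<in> {..<n}"
    then show "\<forall>j<d. b j \<le> (u(i := u i + int s)) j \<and> (u(i := u i + int s)) j + int M \<le> b j + int N"
      "\<forall>j\<ge>d. (u(i := u i + int s)) j = b j"
      using assms by (auto simp: add_increasing2)
  qed (rule grad_nonneg)
  also have "\<dots> \<le> real m * cube_sum d (grad g i) N b"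
    using pos assms(2) by (simp add: mult_right_mono)
  finally show ?thesis using cube_sum_step[of d g M u i n] by linarith
qed

text \<open>The corner is moved from \<open>u\<close> to \<open>w\<close> one coordinate at a time.
  Each move involves the gradient in its own direction only, so the directions add up to
  \<open>grad_sum\<close>.\<close>

lemma cube_sum_path:
  assumes u: "\<forall>j<d. b j \<le> u j \<and> u j + int M \<le> b j + int N" "\<forall>j\<ge>d. u j = b j"
    and w: "\<forall>j<d. b j \<le> w j \<and> w j + int M \<le> b j + int N" "\<forall>j\<ge>d. w j = b j"
    and close: "\<forall>j<d. \<bar>w j - u j\<bar> \<le> int m"
  shows "\<bar>cube_sum d g M w - cube_sum d g M u\<bar> \<le> real m * grad_sum d g N b"
proof -
  define z where "z k = (\<lambda>j. if j < k then w j else u j)" for k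
  have "\<bar>cube_sum d g M (z k) - cube_sum d g M (z 0)\<bar>
      \<le> (\<Sum>i<k. real m * cube_sum d (grad g i) N b)" if "k \<le> d" for k
    using that
  proof (induction k)
    case (Suc k)
    have z: "z k k = u k" "z (Suc k) k = w k" "z (Suc k) = (z k)(k := w k)" "z k = (z (Suc k))(k := u k)"
      by (auto simp: z_def fun_eq_iff less_Suc_eq)
    have close_k: "\<bar>w k - u k\<bar> \<le> int m" using close Suc.prems by simp
    have in_cube: "\<forall>j<d. b j \<le> z k' j \<and> z k' j + int M \<le> b j + int N" "\<forall>j\<ge>d. z k' j = b j" for k'
      using u w by (auto simp: z_def)
    have "\<bar>cube_sum d g M (z (Suc k)) - cube_sum d g M (z k)\<bar> \<le> real m * cube_sum d (grad g k) N b"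
    \<comment> \<open>A move in the negative direction is the reverse of a positive move from the
      other endpoint.\<close>
    proof (cases "u k \<le> w k")
      case True
      then have eq: "z (Suc k) = (z k)(k := z k k + int (nat (w k - u k)))" using z(1,3) by simp
      show ?thesis unfolding eq
        using Suc.prems True close_k in_cube w z(1) by (intro cube_sum_coordinate) auto
    next
      case False
      then have eq: "z k = (z (Suc k))(k := z (Suc k) k + int (nat (u k - w k)))" using z(2,4) by simp
      show ?thesis
        using cube_sum_coordinate[of k d "nat (u k - w k)" m b "z (Suc k)" M N g]
          Suc.prems False close_k in_cube u z(2) eq[symmetric] by (auto simp: abs_minus_commute)
    qed
    with Suc show ?case by simp
  qed simp
  from this[of d] have "\<bar>cube_sum d g M (z d) - cube_sum d g M (z 0)\<bar>
      \<le> (\<Sum>i<d. real m * cube_sum d (grad g i) N b)" by simp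
  moreover have "z d = w" "z 0 = u" using u w by (auto simp: z_def fun_eq_iff not_less)
  ultimately show ?thesis by (simp add: grad_sum_def sum_distrib_left)
qed

lemma cube_sum_double:
  assumes "M > 0"
  shows "cube_sum d g (2 * M) u = (\<Sum>\<epsilon>\<in>cube d 2. cube_sum d g M (\<lambda>i. u i + int M * \<epsilon> i))"
proof -
  have "(\<Sum>\<epsilon>\<in>cube d 2. cube_sum d g M (\<lambda>i. u i + int M * \<epsilon> i))
      = (\<Sum>(\<epsilon>, y)\<in>cube d 2 \<times> cube d M. g (shift (\<lambda>i. u i + int M * \<epsilon> i) y))"
    by (simp add: cube_sum_def sum.cartesian_product)
  \<comment> \<open>Quotient and remainder by \<open>M\<close> give the subcube and the position
    inside it.\<close>
  also have "\<dots> = (\<Sum>y\<in>cube d (2 * M). g (shift u y))"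
  proof (rule sum.reindex_bij_witness[where
        j = "\<lambda>(\<epsilon>, y) i. int M * \<epsilon> i + y i" and
        i = "\<lambda>y. (\<lambda>i. y i div int M, \<lambda>i. y i mod int M)"])
    fix a assume "a \<in> cube d 2 \<times> cube d M"
    then obtain \<epsilon> y where a: "a = (\<epsilon>, y)" "\<epsilon> \<in> cube d 2" "y \<in> cube d M" by auto
    have "int M * \<epsilon> i + y i < 2 * int M" if "i < d" for i
    proof -
      have "\<epsilon> i \<le> 1" "y i < int M" using a that by (force simp: mem_cube)+
      then have "int M * \<epsilon> i \<le> int M * 1" by (intro mult_left_mono) auto
      then show ?thesis using \<open>y i < int M\<close> by linarith
    qed
    then show "(case a of (\<epsilon>, y) \<Rightarrow> \<lambda>i. int M * \<epsilon> i + y i) \<in> cube d (2 * M)"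
      using a by (auto simp: mem_cube)
    have "y i div int M = 0" "y i mod int M = y i" for i
      using a(3) assms by (cases "i < d"; auto simp: mem_cube)+
    then show "(\<lambda>i. (case a of (\<epsilon>, y) \<Rightarrow> \<lambda>i. int M * \<epsilon> i + y i) i div int M,
        \<lambda>i. (case a of (\<epsilon>, y) \<Rightarrow> \<lambda>i. int M * \<epsilon> i + y i) i mod int M) = a"
      using a assms by (auto simp: fun_eq_iff)
    show "g (shift u (case a of (\<epsilon>, y) \<Rightarrow> \<lambda>i. int M * \<epsilon> i + y i))
        = (case a of (\<epsilon>, y) \<Rightarrow> g (shift (\<lambda>i. u i + int M * \<epsilon> i) y))"
      using a by (simp add: shift_def add.assoc)
  next
    fix y assume y: "y \<in> cube d (2 * M)"
    show "(case (\<lambda>i. y i div int M, \<lambda>i. y i mod int M) of (\<epsilon>, y) \<Rightarrow> \<lambda>i. int M * \<epsilon> i + y i) = y"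
      by (simp add: fun_eq_iff)
    have "y i div int M < 2" "0 \<le> y i div int M" if "i < d" for i
    proof -
      have yi: "0 \<le> y i" "y i < int M * 2" using y that by (auto simp: mem_cube)
      then show "0 \<le> y i div int M" using assms by (simp add: pos_imp_zdiv_nonneg_iff)
      show "y i div int M < 2"
      proof (rule ccontr)
        assume "\<not> y i div int M < 2"
        then have "int M * 2 \<le> int M * (y i div int M)" by (intro mult_left_mono) auto
        also have "\<dots> \<le> y i" using assms mult_div_mod_eq[of "int M" "y i"] pos_mod_sign[of "int M" "y i"] by linarith
        finally show False using yi by simp
      qed
    qed
    then show "(\<lambda>i. y i div int M, \<lambda>i. y i mod int M) \<in> cube d 2 \<times> cube d M"
      using y assms by (auto simp: mem_cube)
  qed
  finally show ?thesis by (simp add: cube_sum_def)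
qed

text \<open>Each of the \<open>2 ^ d\<close> subcubes is reached from the corner subcube by moving
  every coordinate by at most \<open>M\<close> inside the doubled cube.\<close>

lemma cube_average_double:
  assumes "M > 0"
  shows "\<bar>cube_sum d g (2 * M) u / real (2 * M) ^ d - cube_sum d g M u / real M ^ d\<bar>
    \<le> real M * grad_sum d g (2 * M) u / real M ^ d"
proof -
  have "\<bar>cube_sum d g (2 * M) u - 2 ^ d * cube_sum d g M u\<bar>
      = \<bar>\<Sum>\<epsilon>\<in>cube d 2. cube_sum d g M (\<lambda>i. u i + int M * \<epsilon> i) - cube_sum d g M u\<bar>"
    using assms by (simp add: cube_sum_double sum_subtractf card_cube)
  also have "\<dots> \<le> (\<Sum>\<epsilon>\<in>cube d 2. real M * grad_sum d g (2 * M) u)"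
  proof (intro order_trans[OF sum_abs] sum_mono cube_sum_path)
    fix \<epsilon> assume \<epsilon>: "\<epsilon> \<in> cube d 2"
    have bounds: "0 \<le> int M * \<epsilon> j" "int M * \<epsilon> j \<le> int M" if "j < d" for j
    proof -
      have "0 \<le> \<epsilon> j" "\<epsilon> j \<le> 1" using \<epsilon> that by (force simp: mem_cube)+
      then show "0 \<le> int M * \<epsilon> j" "int M * \<epsilon> j \<le> int M"
        using mult_left_mono[of "\<epsilon> j" 1 "int M"] by auto
    qed
    show "\<forall>j<d. u j \<le> u j + int M * \<epsilon> j \<and> u j + int M * \<epsilon> j + int M \<le> u j + int (2 * M)"
      using bounds by auto
    show "\<forall>j<d. \<bar>u j + int M * \<epsilon> j - u j\<bar> \<le> int M" using bounds by auto
    show "\<forall>j\<ge>d. u j + int M * \<epsilon> j = u j" using \<epsilon> by (auto simp: mem_cube)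
  qed auto
  also have "\<dots> = 2 ^ d * (real M * grad_sum d g (2 * M) u)" by (simp add: card_cube)
  finally have "\<bar>cube_sum d g (2 * M) u - 2 ^ d * cube_sum d g M u\<bar> / real (2 * M) ^ d
      \<le> 2 ^ d * (real M * grad_sum d g (2 * M) u) / real (2 * M) ^ d"
    by (intro divide_right_mono) auto
  moreover have "\<bar>cube_sum d g (2 * M) u - 2 ^ d * cube_sum d g M u\<bar> / real (2 * M) ^ d
      = \<bar>cube_sum d g (2 * M) u / real (2 * M) ^ d - cube_sum d g M u / real M ^ d\<bar>"
  proof -
    have "cube_sum d g (2 * M) u / real (2 * M) ^ d - cube_sum d g M u / real M ^ d
        = (cube_sum d g (2 * M) u - 2 ^ d * cube_sum d g M u) / real (2 * M) ^ d"
      using assms by (simp add: field_simps)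
    then show ?thesis by simp
  qed
  ultimately show ?thesis by (simp add: power_mult_distrib)
qed

text \<open>A discrete version of the Riesz potential \<open>\<integral> \<bar>\<nabla>g x\<bar> * \<bar>x - u\<bar>\<^sup>1\<^sup>-\<^sup>d \<partial>x\<close>.\<close>

definition dyadic_potential :: "nat \<Rightarrow> ((nat \<Rightarrow> int) \<Rightarrow> real) \<Rightarrow> nat \<Rightarrow> (nat \<Rightarrow> int) \<Rightarrow> real" where
  "dyadic_potential d g K u = (\<Sum>j\<le>K. (1 / 2) ^ (j * (d - 1)) * grad_sum d g (2 ^ j) u)"

lemma grad_sum_nonneg: "grad_sum d g M u \<ge> 0"
  by (auto simp: grad_sum_def cube_sum_def grad_nonneg intro!: sum_nonneg)

text \<open>Telescoping over side lengths, starting from the one-point cube, whose average is the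
  value. The factor \<open>2 ^ (d - 1)\<close> arises because the step from scale \<open>K\<close>
  to \<open>K + 1\<close> is charged with the weight of scale \<open>K + 1\<close>.\<close>

lemma value_minus_average:
  assumes d: "d \<ge> 1"
  shows "\<bar>g u - cube_sum d g (2 ^ K) u / (2 ^ K) ^ d\<bar> \<le> 2 ^ (d - 1) * dyadic_potential d g K u"
proof (induction K)
  case 0
  have "y i = 0" if "y \<in> cube d 1" for y i
    using that by (cases "i < d") (force simp: mem_cube)+
  then have "cube d 1 = {\<lambda>_. 0}" by (auto simp: mem_cube fun_eq_iff)
  then have "cube_sum d g 1 u = g u" by (simp add: cube_sum_def shift_def)
  then show ?case using grad_sum_nonneg[of d g 1 u] by (simp add: dyadic_potential_def)
next
  case (Suc K)
  have "\<bar>cube_sum d g (2 * 2 ^ K) u / real (2 * 2 ^ K) ^ d - cube_sum d g (2 ^ K) u / real (2 ^ K) ^ d\<bar>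
      \<le> real (2 ^ K) * grad_sum d g (2 * 2 ^ K) u / real (2 ^ K) ^ d"
    by (rule cube_average_double) simp
  also have "real (2 ^ K) * grad_sum d g (2 * 2 ^ K) u / real (2 ^ K) ^ d
      = 2 ^ (d - 1) * ((1 / 2) ^ (Suc K * (d - 1)) * grad_sum d g (2 ^ Suc K) u)"
  proof -
    obtain e where e: "d = Suc e" using d by (cases d) auto
    have "real (2 ^ K) / real (2 ^ K) ^ d = 1 / (2 ^ K) ^ e" by (simp add: e)
    also have "\<dots> = 2 ^ e * (1 / 2) ^ (Suc K * e)"
      by (simp add: power_mult power_add divide_simps)
    finally have "real (2 ^ K) / real (2 ^ K) ^ d = 2 ^ (d - 1) * (1 / 2) ^ (Suc K * (d - 1))"
      by (simp only: e diff_Suc_1)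
    moreover have "real (2 ^ K) * X / real (2 ^ K) ^ d = real (2 ^ K) / real (2 ^ K) ^ d * X" for X by simp
    ultimately show ?thesis by (simp only: mult.assoc power_Suc)
  qed
  finally have "\<bar>cube_sum d g (2 ^ Suc K) u / (2 ^ Suc K) ^ d - cube_sum d g (2 ^ K) u / (2 ^ K) ^ d\<bar>
      \<le> 2 ^ (d - 1) * ((1 / 2) ^ (Suc K * (d - 1)) * grad_sum d g (2 ^ Suc K) u)" by simp
  with Suc.IH show ?case
    unfolding dyadic_potential_def sum.atMost_Suc distrib_left by linarith
qed

text \<open>Both values are compared with averages over cubes of side \<open>2 ^ K\<close>, and the
  averages with each other. Corners within \<open>v \<plusminus> 2 ^ K\<close> plus the side require
  width \<open>3 * 2 ^ K\<close>, rounded up to \<open>2 ^ (K + 2)\<close> to remain dyadic.\<close>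

lemma oscillation_bound:
  assumes d: "d \<ge> 1"
    and close: "\<forall>j<d. \<bar>v j - w j\<bar> \<le> 2 ^ K" "\<forall>j\<ge>d. v j = w j"
    and b: "b = (\<lambda>j. if j < d then v j - 2 ^ K else v j)"
  shows "\<bar>g v - g w\<bar> \<le> 4 ^ (d - 1) * (dyadic_potential d g K v + dyadic_potential d g K w
    + (1 / 2) ^ ((K + 2) * (d - 1)) * grad_sum d g (2 ^ (K + 2)) b)"
proof -
  define A where "A u = cube_sum d g (2 ^ K) u / (2 ^ K) ^ d" for u
  have "\<bar>cube_sum d g (2 ^ K) v - cube_sum d g (2 ^ K) w\<bar> \<le> real (2 ^ K) * grad_sum d g (2 ^ (K + 2)) b"
    using close by (intro cube_sum_path) (auto simp: b abs_le_iff)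
  then have "\<bar>cube_sum d g (2 ^ K) v - cube_sum d g (2 ^ K) w\<bar> / (2 ^ K) ^ d
      \<le> real (2 ^ K) * grad_sum d g (2 ^ (K + 2)) b / (2 ^ K) ^ d"
    by (intro divide_right_mono) auto
  moreover have "\<bar>A v - A w\<bar> = \<bar>cube_sum d g (2 ^ K) v - cube_sum d g (2 ^ K) w\<bar> / (2 ^ K) ^ d"
    by (simp add: A_def diff_divide_distrib[symmetric])
  moreover have "real (2 ^ K) * grad_sum d g (2 ^ (K + 2)) b / (2 ^ K) ^ d
      = 4 ^ (d - 1) * ((1 / 2) ^ ((K + 2) * (d - 1)) * grad_sum d g (2 ^ (K + 2)) b)"
  proof -
    obtain e where e: "d = Suc e" using d by (cases d) auto
    have "(4 :: real) ^ e = (2 ^ 2) ^ e" by simp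
    then have "4 ^ e * (1 / 2) ^ ((K + 2) * e) = 1 / (2 ^ K :: real) ^ e"
      by (simp only: power_mult power_add power_mult_distrib power_one_over) (simp add: divide_simps)
    moreover have "real (2 ^ K) / (2 ^ K) ^ d = 1 / (2 ^ K) ^ e" by (simp add: e)
    ultimately have "real (2 ^ K) / (2 ^ K) ^ d = 4 ^ (d - 1) * (1 / 2) ^ ((K + 2) * (d - 1))"
      by (simp only: e diff_Suc_1)
    moreover have "real (2 ^ K) * X / (2 ^ K) ^ d = real (2 ^ K) / (2 ^ K) ^ d * X" for X by simp
    ultimately show ?thesis by (simp only: mult.assoc)
  qed
  ultimately have "\<bar>A v - A w\<bar> \<le> 4 ^ (d - 1) * ((1 / 2) ^ ((K + 2) * (d - 1)) * grad_sum d g (2 ^ (K + 2)) b)"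
    by simp
  moreover have "\<bar>g u - A u\<bar> \<le> 4 ^ (d - 1) * dyadic_potential d g K u" for u
  proof -
    have "0 \<le> dyadic_potential d g K u"
      by (auto simp: dyadic_potential_def grad_sum_nonneg intro!: sum_nonneg)
    then have "2 ^ (d - 1) * dyadic_potential d g K u \<le> 4 ^ (d - 1) * dyadic_potential d g K u"
      by (intro mult_right_mono power_mono) auto
    then show ?thesis using value_minus_average[OF d, of g u K] by (simp add: A_def)
  qed
  note this[of v] this[of w]
  ultimately show ?thesis by (simp only: distrib_left) linarith
qed


section \<open>Energy on the torus and the box\<close>

text \<open>Terms with \<open>F x = 0\<close> are exempt from all conditions on
  \<open>\<pi>\<close>. This permits lattice edges outside the box, which correspond to no edge of
  the graph.\<close>

lemma sum_le_card_fibres: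
  fixes F :: "'a \<Rightarrow> real" and f :: "'b \<Rightarrow> real"
  assumes fin: "finite S" "finite T" and f: "\<And>y. y \<in> T \<Longrightarrow> 0 \<le> f y"
    and le: "\<And>x. x \<in> S \<Longrightarrow> F x \<noteq> 0 \<Longrightarrow> \<pi> x \<in> T \<and> F x \<le> f (\<pi> x)"
    and card: "\<And>y. y \<in> T \<Longrightarrow> card {x \<in> S. F x \<noteq> 0 \<and> \<pi> x = y} \<le> m"
  shows "sum F S \<le> real m * sum f T"
proof -
  let ?S = "{x \<in> S. F x \<noteq> 0}"
  have "sum F S = sum F ?S" using fin by (intro sum.mono_neutral_right) auto
  also have "\<dots> \<le> (\<Sum>x\<in>?S. f (\<pi> x))" using le by (intro sum_mono) auto
  also have "\<dots> = (\<Sum>y\<in>T. \<Sum>x\<in>{x \<in> ?S. \<pi> x = y}. f (\<pi> x))"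
    using fin le by (intro sum.group[symmetric]) auto
  also have "\<dots> \<le> (\<Sum>y\<in>T. real m * f y)"
  proof (intro sum_mono)
    fix y assume y: "y \<in> T"
    have "(\<Sum>x\<in>{x \<in> ?S. \<pi> x = y}. f (\<pi> x)) = (\<Sum>x\<in>{x \<in> S. F x \<noteq> 0 \<and> \<pi> x = y}. f y)"
      by (intro sum.cong) auto
    also have "\<dots> \<le> real m * f y" using card[OF y] f[OF y] by (simp add: mult_right_mono)
    finally show "(\<Sum>x\<in>{x \<in> ?S. \<pi> x = y}. f (\<pi> x)) \<le> real m * f y" .
  qed
  finally show ?thesis by (simp add: sum_distrib_left)
qed

text \<open>One of the three terms in \<open>oscillation_bound\<close> is at least a third of the
  total. Each has the form required by \<open>energy_lower_bound\<close>, and all cubes involved lie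
  in the large one whose energy is bounded.\<close>

lemma grid_energy_lower_bound:
  fixes d :: nat and p :: real
  assumes d: "d \<ge> 3" and p: "p > 2"
  shows "\<exists>c>0. \<forall>t>2. \<forall>g v w K.
    (\<forall>j<d. \<bar>v j - w j\<bar> \<le> 2 ^ K) \<longrightarrow> (\<forall>j\<ge>d. v j = w j) \<longrightarrow> t \<le> \<bar>g v - g w\<bar> \<longrightarrow>
    c * tail_rate d p t \<le> (\<Sum>i<d. cube_sum d (\<lambda>x. grad g i x powr p + (grad g i x)\<^sup>2) (2 ^ (K + 2))
      (\<lambda>j. if j < d then v j - 2 ^ K else v j))"
proof -
  \<comment> \<open>The 3 is for the choice among three terms, the power of 4 is the constant of
    \<open>oscillation_bound\<close>.\<close>
  define \<kappa> where "\<kappa> = 1 / (3 * 4 ^ (d - 1) :: real)"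
  have \<kappa>: "\<kappa> > 0" by (simp add: \<kappa>_def)
  obtain c where c: "c > 0" and bound: "\<And>t K (Z :: (nat \<times> (nat \<Rightarrow> int)) set) G Q.
    t > 2 \<Longrightarrow> finite Z \<Longrightarrow> (\<forall>e\<in>Z. 0 \<le> G e) \<Longrightarrow>
    (\<forall>j\<le>K. Q j \<subseteq> Z \<and> real (card (Q j)) \<le> real d * 2 ^ (j * d)) \<Longrightarrow>
    \<kappa> * t \<le> (\<Sum>j\<le>K. (1 / 2) ^ (j * (d - 1)) * (\<Sum>e\<in>Q j. G e)) \<Longrightarrow>
    c * tail_rate d p t \<le> (\<Sum>e\<in>Z. G e powr p + (G e)\<^sup>2)"
    using energy_lower_bound[OF d p \<kappa>, of "real d", where 'a = "nat \<times> (nat \<Rightarrow> int)"] d by auto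
  have main: "c * tail_rate d p t \<le> (\<Sum>i<d. cube_sum d (\<lambda>x. grad g i x powr p + (grad g i x)\<^sup>2) (2 ^ (K + 2)) b)"
    if t: "t > 2" and close: "\<forall>j<d. \<bar>v j - w j\<bar> \<le> 2 ^ K" "\<forall>j\<ge>d. v j = w j" and osc: "t \<le> \<bar>g v - g w\<bar>"
      and b: "b = (\<lambda>j. if j < d then v j - 2 ^ K else v j)"
    for t g v w K b
  proof -
    define Z where "Z = {..<d} \<times> shift b ` cube d (2 ^ (K + 2))"
    define G where "G = (\<lambda>(i, x). grad g i x)"
    define Q where "Q u j = {..<d} \<times> shift u ` cube d (2 ^ j)" for u and j :: nat
    have sum_Q: "(\<Sum>e\<in>Q u j. h (fst e) (snd e)) = (\<Sum>i<d. cube_sum d (h i) (2 ^ j) u)"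
      for u j and h :: "nat \<Rightarrow> (nat \<Rightarrow> int) \<Rightarrow> real"
    proof -
      have "cube_sum d (h i) (2 ^ j) u = sum (h i) (shift u ` cube d (2 ^ j))" for i
        by (simp add: cube_sum_def sum.reindex[OF inj_shift])
      then show ?thesis by (simp add: Q_def sum.cartesian_product split_beta)
    qed
    have sum_G: "(\<Sum>e\<in>Q u j. G e) = grad_sum d g (2 ^ j) u" for u j
      using sum_Q[of "grad g" u j] by (simp add: G_def grad_sum_def split_beta)
    have card_Q: "real (card (Q u j)) \<le> real d * 2 ^ (j * d)" for u j
      by (simp add: Q_def card_cartesian_product card_image[OF inj_shift] card_cube power_mult)
    have finZ: "finite Z" by (simp add: Z_def)
    have G: "\<forall>e\<in>Z. 0 \<le> G e" by (auto simp: G_def grad_nonneg)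
    have subset: "Q u j \<subseteq> Z" if j: "j \<le> K" and u: "u = v \<or> u = w" for u j
    proof -
      have pow: "(2::int) ^ j \<le> 2 ^ K" using j by (intro power_increasing) auto
      have close_u: "\<bar>v i - u i\<bar> \<le> 2 ^ K" if "i < d" for i using u close that by auto
      have "\<forall>i<d. b i \<le> u i \<and> u i + int (2 ^ j) \<le> b i + int (2 ^ (K + 2))"
      proof (intro allI impI)
        fix i assume i: "i < d"
        have bi: "b i = v i - 2 ^ K" using i by (simp add: b)
        have "u i \<ge> v i - 2 ^ K" "u i \<le> v i + 2 ^ K"
          using close_u[OF i] by (simp_all add: abs_le_iff)
        moreover have "int (2 ^ (K + 2)) = 4 * 2 ^ K" "int (2 ^ j) = 2 ^ j" "(0 :: int) \<le> 2 ^ K" by simp_all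
        ultimately show "b i \<le> u i \<and> u i + int (2 ^ j) \<le> b i + int (2 ^ (K + 2))"
          using pow unfolding bi by (intro conjI; linarith)
      qed
      moreover have "\<forall>i\<ge>d. u i = b i" using u close by (auto simp: b)
      ultimately have "shift u ` cube d (2 ^ j) \<subseteq> shift b ` cube d (2 ^ (K + 2))"
        by (rule shift_cube_subset)
      then show ?thesis by (auto simp: Q_def Z_def)
    qed
    have energy: "(\<Sum>e\<in>Z. G e powr p + (G e)\<^sup>2)
        = (\<Sum>i<d. cube_sum d (\<lambda>x. grad g i x powr p + (grad g i x)\<^sup>2) (2 ^ (K + 2)) b)"
      using sum_Q[of "\<lambda>i x. grad g i x powr p + (grad g i x)\<^sup>2" b "K + 2"]
      by (simp add: G_def split_beta Z_def Q_def)
    have "t \<le> 4 ^ (d - 1) * (dyadic_potential d g K v + dyadic_potential d g K w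
      + (1 / 2) ^ ((K + 2) * (d - 1)) * grad_sum d g (2 ^ (K + 2)) b)"
      using oscillation_bound[of d v w K b g] d close b osc by simp
    then have "3 * (\<kappa> * t) \<le> dyadic_potential d g K v + dyadic_potential d g K w
      + (1 / 2) ^ ((K + 2) * (d - 1)) * grad_sum d g (2 ^ (K + 2)) b"
      by (simp add: \<kappa>_def field_simps)
    then have "\<kappa> * t \<le> dyadic_potential d g K v \<or> \<kappa> * t \<le> dyadic_potential d g K w \<or>
        \<kappa> * t \<le> (1 / 2) ^ ((K + 2) * (d - 1)) * grad_sum d g (2 ^ (K + 2)) b" by linarith
    then consider u where "u = v \<or> u = w" "\<kappa> * t \<le> dyadic_potential d g K u"
      | "\<kappa> * t \<le> (1 / 2) ^ ((K + 2) * (d - 1)) * grad_sum d g (2 ^ (K + 2)) b" by blast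
    then show ?thesis
    proof cases
      case 1
      then show ?thesis
        unfolding energy[symmetric]
        by (intro bound[OF t finZ G, where Q = "Q u" and K = K])
          (use subset card_Q in \<open>auto simp: dyadic_potential_def sum_G\<close>)
    next
      case 2
      \<comment> \<open>The single large cube is a family of edge sets that is empty at all other
        scales.\<close>
      define Q' where "Q' j = (if j = K + 2 then Z else {})" for j
      have "\<forall>j\<le>K + 2. Q' j \<subseteq> Z \<and> real (card (Q' j)) \<le> real d * 2 ^ (j * d)"
        using card_Q[of b "K + 2"] by (auto simp: Q'_def Z_def Q_def)
      moreover have "(\<Sum>j\<le>K + 2. (1 / 2) ^ (j * (d - 1)) * (\<Sum>e\<in>Q' j. G e))
          = (\<Sum>j\<le>K + 2. if j = K + 2 then (1 / 2) ^ ((K + 2) * (d - 1)) * grad_sum d g (2 ^ (K + 2)) b else 0)"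
        using sum_G[of b "K + 2"] by (intro sum.cong) (auto simp: Q'_def Z_def Q_def)
      ultimately show ?thesis
        unfolding energy[symmetric] using 2 by (intro bound[OF t finZ G, where Q = Q' and K = "K + 2"]) auto
    qed
  qed
  show ?thesis using c main by blast
qed

section \<open>From gradients on the lattice to edges of the graph\<close>

lemma surface_energy_edge:
  assumes "is_orientation E \<omega>" "{a, b} \<in> E" "\<And>x. U (- x) = U x"
  shows "U (edge_gradient \<omega> h {a, b}) = U \<bar>h a - h b\<bar>"
proof -
  have "{a, b} = {fst (\<omega> {a, b}), snd (\<omega> {a, b})}" using assms(1)[unfolded is_orientation_def] assms(2) by (rule bspec)
  then have "edge_gradient \<omega> h {a, b} = h a - h b \<or> edge_gradient \<omega> h {a, b} = - (h a - h b)"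
    unfolding edge_gradient_def by (auto simp: doubleton_eq_iff)
  then show ?thesis using assms(3)[of "h a - h b"] by (auto simp: abs_if)
qed

lemma edges_of_orientation:
  obtains \<omega> where "is_orientation (edges_of V adj) \<omega>"
proof -
  have "\<forall>e\<in>edges_of V adj. \<exists>q. e = {fst q, snd q}" by (force simp: edges_of_def)
  then show ?thesis using that unfolding is_orientation_def by metis
qed

lemma edges_of_subset: "e \<in> edges_of V adj \<Longrightarrow> e \<subseteq> V"
  by (auto simp: edges_of_def)

lemma finite_edges_of: "finite V \<Longrightarrow> finite (edges_of V adj)"
  by (rule finite_subset[of _ "Pow V"]) (auto simp: edges_of_def)

lemma card_edges_of:
  assumes "e \<in> edges_of V adj"
  shows "finite e" "card e \<le> 2"
  using assms by (auto simp: edges_of_def card_insert_if)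

text \<open>For a fixed direction, a lattice edge over the graph edge \<open>e\<close> has its base
  point over one of the two ends of \<open>e\<close>, so at most \<open>2 * m\<close> lattice edges
  lie over \<open>e\<close>. The factor \<open>d\<close> counts directions.\<close>

lemma cube_energy_le_surface_energy:
  fixes h :: "'v \<Rightarrow> real"
  assumes U: "U = (\<lambda>x. \<bar>x\<bar> powr p + x\<^sup>2)" and fin: "finite V"
    and edge: "\<And>i x. i < d \<Longrightarrow> grad g i x \<noteq> 0 \<Longrightarrow>
      {\<rho> x, \<rho> (x(i := x i + 1))} \<in> edges_of V adj \<and> g x = h (\<rho> x) \<and> g (x(i := x i + 1)) = h (\<rho> (x(i := x i + 1)))"
    and card: "\<And>a. card {x \<in> shift b ` cube d N. \<rho> x = a} \<le> m"
  shows "(\<Sum>i<d. cube_sum d (\<lambda>x. grad g i x powr p + (grad g i x)\<^sup>2) N b)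
    \<le> real (2 * m * d) * surface_energy U (edges_of V adj) h"
proof -
  let ?E = "edges_of V adj" and ?S = "shift b ` cube d N"
  have even: "U (- x) = U x" for x by (simp add: U)
  obtain \<omega> where \<omega>: "is_orientation ?E \<omega>" by (rule edges_of_orientation)
  have H: "surface_energy U ?E h = (\<Sum>e\<in>?E. U (edge_gradient \<omega> h e))"
    by (rule surface_energy_orientation[OF \<omega>, of U, OF even])
  have "cube_sum d (\<lambda>x. grad g i x powr p + (grad g i x)\<^sup>2) N b
      \<le> real (2 * m) * (\<Sum>e\<in>?E. U (edge_gradient \<omega> h e))" if i: "i < d" for i
  proof -
    define F where "F x = grad g i x powr p + (grad g i x)\<^sup>2" for x
    have F: "grad g i x \<noteq> 0" if "F x \<noteq> 0" for x using that by (auto simp: F_def)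
    have "sum F ?S \<le> real (2 * m) * (\<Sum>e\<in>?E. U (edge_gradient \<omega> h e))"
    proof (rule sum_le_card_fibres[where \<pi> = "\<lambda>x. {\<rho> x, \<rho> (x(i := x i + 1))}"])
      fix x assume "F x \<noteq> 0"
      note e = edge[OF i F[OF this]]
      have "U (edge_gradient \<omega> h {\<rho> x, \<rho> (x(i := x i + 1))}) = U \<bar>h (\<rho> x) - h (\<rho> (x(i := x i + 1)))\<bar>"
        using e even by (intro surface_energy_edge[OF \<omega>]) auto
      also have "\<dots> = F x" using e by (simp add: F_def U grad_def abs_minus_commute)
      finally show "{\<rho> x, \<rho> (x(i := x i + 1))} \<in> ?E \<and> F x \<le> U (edge_gradient \<omega> h {\<rho> x, \<rho> (x(i := x i + 1))})"
        using e by simp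
    next
      fix e assume e: "e \<in> ?E"
      have "{x \<in> ?S. F x \<noteq> 0 \<and> {\<rho> x, \<rho> (x(i := x i + 1))} = e} \<subseteq> (\<Union>a\<in>e. {x \<in> ?S. \<rho> x = a})"
        by auto
      then have "card {x \<in> ?S. F x \<noteq> 0 \<and> {\<rho> x, \<rho> (x(i := x i + 1))} = e} \<le> card (\<Union>a\<in>e. {x \<in> ?S. \<rho> x = a})"
        using card_edges_of(1)[OF e] by (intro card_mono) auto
      also have "\<dots> \<le> (\<Sum>a\<in>e. card {x \<in> ?S. \<rho> x = a})"
        using card_edges_of(1)[OF e] by (rule card_UN_le)
      also have "\<dots> \<le> (\<Sum>a\<in>e. m)" using card by (intro sum_mono) auto
      also have "\<dots> \<le> 2 * m" using card_edges_of(2)[OF e] by simp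
      finally show "card {x \<in> ?S. F x \<noteq> 0 \<and> {\<rho> x, \<rho> (x(i := x i + 1))} = e} \<le> 2 * m" .
    qed (use finite_edges_of[OF fin] in \<open>auto simp: U\<close>)
    then show ?thesis by (simp add: F_def cube_sum_def sum.reindex[OF inj_shift])
  qed
  then have "(\<Sum>i<d. cube_sum d (\<lambda>x. grad g i x powr p + (grad g i x)\<^sup>2) N b)
      \<le> (\<Sum>i<d. real (2 * m) * surface_energy U ?E h)"
    unfolding H by (intro sum_mono) auto
  then show ?thesis by (simp add: mult_ac)
qed

text \<open>The lower bound on \<open>2 ^ K\<close> lets the scale span the graph. The upper bound
  keeps the cube of side \<open>2 ^ (K + 2)\<close> within \<open>8 * L\<close>, hence within
  boundedly many periods of the torus.\<close>

lemma exists_power2_scale: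
  assumes "L > 0"
  obtains K where "int L \<le> 2 ^ K" "2 ^ K \<le> 2 * int L"
proof -
  obtain J where J: "2 ^ J \<le> real L" "real L < 2 ^ Suc J"
    using exists_power2_between[of "real L"] assms by auto
  have "2 ^ J \<le> L" using J(1) by (metis of_nat_le_iff of_nat_numeral of_nat_power)
  moreover have "L < 2 ^ Suc J" using J(2) by (metis of_nat_less_iff of_nat_numeral of_nat_power)
  ultimately have "int L \<le> 2 ^ Suc J" "2 ^ Suc J \<le> 2 * int L"
    by (simp_all flip: of_nat_le_iff of_nat_less_iff[where 'a = int])
  then show ?thesis by (rule that)
qed

lemma finite_box_vertices: "finite (box_vertices d L)"
  unfolding box_vertices_def by (intro finite_PiE) auto

lemma finite_torus_vertices: "finite (torus_vertices d L)"
  unfolding torus_vertices_def by (intro finite_PiE) auto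

text \<open>A lattice edge leaving the box has its inner end in the boundary, where \<open>h\<close>
  is zero; the zero extension therefore has no gradient outside the box edges. On a shifted cube the
  coordinates from \<open>d\<close> on are fixed, so \<open>restrict\<close> is injective there and
  no edge is counted over several periods.\<close>

lemma box_cube_energy:
  assumes U: "U = (\<lambda>x. \<bar>x\<bar> powr p + x\<^sup>2)"
    and zero: "\<And>x. x \<in> box_boundary d L \<Longrightarrow> h x = 0"
    and g_def: "g = (\<lambda>x. if restrict x {..<d} \<in> box_vertices d L then h (restrict x {..<d}) else 0)"
  shows "(\<Sum>i<d. cube_sum d (\<lambda>x. grad g i x powr p + (grad g i x)\<^sup>2) N b)
    \<le> real (2 * d) * surface_energy U (edges_of (box_vertices d L) (lattice_adj d)) h"
proof -
  let ?V = "box_vertices d L"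
  have edge: "{restrict x {..<d}, restrict (x(i := x i + 1)) {..<d}} \<in> edges_of ?V (lattice_adj d)
      \<and> g x = h (restrict x {..<d}) \<and> g (x(i := x i + 1)) = h (restrict (x(i := x i + 1)) {..<d})"
    if i: "i < d" and nz: "grad g i x \<noteq> 0" for i x
  proof -
    let ?r = "restrict x {..<d}" and ?s = "restrict (x(i := x i + 1)) {..<d}"
    have adj: "lattice_adj d ?r ?s" "lattice_adj d ?s ?r"
      using i by (auto simp: lattice_adj_def)
    have lat: "?r \<in> int_lattice d" "?s \<in> int_lattice d" by (auto simp: int_lattice_def)
    have "h ?s = 0" if "?r \<notin> ?V" "?s \<in> ?V" using zero that adj lat by (auto simp: box_boundary_def)
    moreover have "h ?r = 0" if "?s \<notin> ?V" "?r \<in> ?V" using zero that adj lat by (auto simp: box_boundary_def)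
    ultimately have "?r \<in> ?V" "?s \<in> ?V" using nz by (auto simp: grad_def g_def split: if_splits)
    then show ?thesis using adj by (auto simp: edges_of_def g_def)
  qed
  have "card {x \<in> shift b ` cube d N. restrict x {..<d} = a} \<le> 1" for a
  proof -
    have "x = y" if "x \<in> shift b ` cube d N" "y \<in> shift b ` cube d N" "restrict x {..<d} = restrict y {..<d}" for x y
    proof
      fix i
      show "x i = y i"
      proof (cases "i < d")
        case True
        then show ?thesis using fun_cong[OF that(3), of i] by simp
      next
        case False
        then show ?thesis using that(1,2) by (auto simp: shift_def mem_cube)
      qed
    qed
    then show ?thesis by (simp add: card_le_Suc0_iff_eq)
  qed
  then show ?thesis
    using cube_energy_le_surface_energy[where \<rho> = "\<lambda>x. restrict x {..<d}" and m = 1, OF U finite_box_vertices edge]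
    by simp
qed

text \<open>Adding \<open>L - 1\<close> before the reduction and subtracting it afterwards moves the
  residues from \<open>0..2L-1\<close> to the range of \<open>torus_vertices\<close>.\<close>

definition torus_wrap :: "nat \<Rightarrow> nat \<Rightarrow> (nat \<Rightarrow> int) \<Rightarrow> nat \<Rightarrow> int" where
  "torus_wrap d L x = (\<lambda>i\<in>{..<d}. (x i + int L - 1) mod (2 * int L) - int L + 1)"

text \<open>A cube of side at most \<open>8 * L\<close> meets at most four periods of length
  \<open>2 * L\<close> in each direction, so every torus vertex has at most \<open>4 ^ d\<close>
  preimages in it.\<close>

lemma torus_cube_energy:
  assumes U: "U = (\<lambda>x. \<bar>x\<bar> powr p + x\<^sup>2)" and L: "L > 0" and N: "int N \<le> 8 * int L"
    and g_def: "g = (\<lambda>x. h (torus_wrap d L x))"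
  shows "(\<Sum>i<d. cube_sum d (\<lambda>x. grad g i x powr p + (grad g i x)\<^sup>2) N b)
    \<le> real (2 * 4 ^ d * d) * surface_energy U (edges_of (torus_vertices d L) (torus_adj d L)) h"
proof -
  let ?V = "torus_vertices d L" and ?R = "torus_wrap d L"
  have R: "?R x \<in> ?V" for x
  proof -
    have "- int L + 1 \<le> (x i + int L - 1) mod (2 * int L) - int L + 1"
      "(x i + int L - 1) mod (2 * int L) - int L + 1 \<le> int L" for i
      using pos_mod_bound[of "2 * int L" "x i + int L - 1"] pos_mod_sign[of "2 * int L" "x i + int L - 1"] L
      by linarith+
    then show ?thesis by (auto simp: torus_wrap_def torus_vertices_def)
  qed
  have edge: "{?R x, ?R (x(i := x i + 1))} \<in> edges_of ?V (torus_adj d L)" if i: "i < d" for i x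
  proof -
    have "[?R x i - ?R (x(i := x i + 1)) i = - 1] (mod (2 * int L))"
    proof -
      have "((a mod n - int L + 1) - ((a + 1) mod n - int L + 1)) mod n = - 1 mod n" for a n :: int
      proof -
        have "((a mod n - int L + 1) - ((a + 1) mod n - int L + 1)) mod n = (a mod n - (a + 1) mod n) mod n"
          by (rule arg_cong[where f = "\<lambda>z. z mod n"]) simp
        also have "\<dots> = (a - (a + 1)) mod n" by (simp only: mod_diff_eq)
        finally show ?thesis by simp
      qed
      from this[of "x i + int L - 1" "2 * int L"] show ?thesis
        using i by (simp add: cong_def torus_wrap_def algebra_simps)
    qed
    then have "torus_adj d L (?R x) (?R (x(i := x i + 1)))"
      using i unfolding torus_adj_def by (intro exI[of _ i]) (auto simp: torus_wrap_def)
    then show ?thesis using R by (auto simp: edges_of_def)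
  qed
  have "card {x \<in> shift b ` cube d N. ?R x = a} \<le> 4 ^ d" for a
  proof -
    \<comment> \<open>\<open>?q\<close> numbers the periods from the corner \<open>b\<close>;
      together with the residue fixed by \<open>?R x = a\<close> it determines
      \<open>x\<close>.\<close>
    let ?q = "\<lambda>x i. if i < d then (x i - b i) div (2 * int L) else 0"
    have "card {x \<in> shift b ` cube d N. ?R x = a} \<le> card (cube d 4)"
    proof (rule card_inj_on_le)
      show "inj_on ?q {x \<in> shift b ` cube d N. ?R x = a}"
      proof (intro inj_onI ext)
        fix x y i
        assume x: "x \<in> {x \<in> shift b ` cube d N. ?R x = a}" and y: "y \<in> {x \<in> shift b ` cube d N. ?R x = a}"
          and q: "?q x = ?q y"
        show "x i = y i"
        proof (cases "i < d")
          case True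
          have "?R x i = ?R y i" using x y by simp
          then have "(x i + int L - 1) mod (2 * int L) = (y i + int L - 1) mod (2 * int L)"
            using True by (simp add: torus_wrap_def)
          then have "2 * int L dvd (x i + int L - 1) - (y i + int L - 1)" by (rule mod_eq_dvd_iff[THEN iffD1])
          then have "2 * int L dvd (x i - b i) - (y i - b i)" by simp
          then have "(x i - b i) mod (2 * int L) = (y i - b i) mod (2 * int L)" by (rule mod_eq_dvd_iff[THEN iffD2])
          moreover have "(x i - b i) div (2 * int L) = (y i - b i) div (2 * int L)"
            using fun_cong[OF q, of i] True by simp
          ultimately have "x i - b i = y i - b i" by (metis div_mult_mod_eq)
          then show ?thesis by simp
        next
          case False
          then show ?thesis using x y by (auto simp: shift_def mem_cube)
        qed
      qed
      show "?q ` {x \<in> shift b ` cube d N. ?R x = a} \<subseteq> cube d 4"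
      proof clarify
        fix y assume y: "y \<in> cube d N"
        have "0 \<le> y i div (2 * int L)" "y i div (2 * int L) < 4" if "i < d" for i
        proof -
          have yi: "0 \<le> y i" "y i < 8 * int L" using y that N by (fastforce simp: mem_cube)+
          then show "0 \<le> y i div (2 * int L)" using L by (simp add: pos_imp_zdiv_nonneg_iff)
          show "y i div (2 * int L) < 4"
          proof (rule ccontr)
            assume "\<not> y i div (2 * int L) < 4"
            then have "2 * int L * 4 \<le> 2 * int L * (y i div (2 * int L))" by (intro mult_left_mono) auto
            also have "\<dots> \<le> y i"
              using L mult_div_mod_eq[of "2 * int L" "y i"] pos_mod_sign[of "2 * int L" "y i"] by linarith
            finally show False using yi by simp
          qed
        qed
        then show "?q (shift b y) \<in> cube d 4" by (auto simp: mem_cube shift_def)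
      qed
    qed simp
    then show ?thesis by (simp add: card_cube)
  qed
  then show ?thesis
    using cube_energy_le_surface_energy[where \<rho> = ?R and m = "4 ^ d" and g = g and h = h and adj = "torus_adj d L", OF U finite_torus_vertices] edge
    by (simp add: g_def)
qed

text \<open>The value at \<open>v\<close> is compared with the zero value of the extension at a
  point outside the box, at distance \<open>2 ^ K\<close>.\<close>

lemma box_energy_lower_bound:
  assumes d: "d \<ge> 3" and p: "p > 2" and U: "U = (\<lambda>x. \<bar>x\<bar> powr p + x\<^sup>2)"
  shows "\<exists>c>0. \<forall>L>0. \<forall>v\<in>box_vertices d L. \<forall>t>2. \<forall>h.
    (\<forall>x\<in>box_boundary d L. h x = 0) \<longrightarrow> t < \<bar>h v\<bar> \<longrightarrow>
    c * tail_rate d p t \<le> surface_energy U (edges_of (box_vertices d L) (lattice_adj d)) h"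
proof -
  obtain c where c: "c > 0" and bound: "\<forall>t>2. \<forall>g v w K.
    (\<forall>j<d. \<bar>v j - w j\<bar> \<le> 2 ^ K) \<longrightarrow> (\<forall>j\<ge>d. v j = w j) \<longrightarrow> t \<le> \<bar>g v - g w\<bar> \<longrightarrow>
    c * tail_rate d p t \<le> (\<Sum>i<d. cube_sum d (\<lambda>x. grad g i x powr p + (grad g i x)\<^sup>2) (2 ^ (K + 2))
      (\<lambda>j. if j < d then v j - 2 ^ K else v j))"
    using grid_energy_lower_bound[OF d p] by (elim exE conjE)
  have "c / real (2 * d) * tail_rate d p t \<le> surface_energy U (edges_of (box_vertices d L) (lattice_adj d)) h"
    if L: "L > 0" and v: "v \<in> box_vertices d L" and t: "t > 2"
      and zero: "\<forall>x\<in>box_boundary d L. h x = 0" and h: "t < \<bar>h v\<bar>" for L v t h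
  proof -
    obtain K where K: "int L \<le> 2 ^ K" using exists_power2_scale[OF L] by metis
    define g where "g = (\<lambda>x. if restrict x {..<d} \<in> box_vertices d L then h (restrict x {..<d}) else 0)"
    \<comment> \<open>Since \<open>v 0 \<ge> 1\<close> and \<open>2 ^ K \<ge> L\<close>, one
      coordinate move suffices to leave the box.\<close>
    define w where "w = v(0 := v 0 + 2 ^ K)"
    have "restrict v {..<d} = v" using v by (simp add: box_vertices_def)
    then have "g v = h v" using v by (simp add: g_def)
    moreover have "g w = 0"
    proof -
      have "1 \<le> v 0" using v d by (auto simp: box_vertices_def PiE_def Pi_def)
      then have "int L < w 0" using K unfolding w_def fun_upd_same by linarith
      then have "restrict w {..<d} 0 \<notin> {1..int L}" using d by simp
      then have "restrict w {..<d} \<notin> box_vertices d L" using d unfolding box_vertices_def PiE_def Pi_def by fastforce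
      then show ?thesis by (simp add: g_def)
    qed
    ultimately have "t \<le> \<bar>g v - g w\<bar>" using h by simp
    then have "c * tail_rate d p t \<le> (\<Sum>i<d. cube_sum d (\<lambda>x. grad g i x powr p + (grad g i x)\<^sup>2) (2 ^ (K + 2))
      (\<lambda>j. if j < d then v j - 2 ^ K else v j))"
      using d by (intro bound[rule_format, OF t, of v w]) (auto simp: w_def)
    also have "\<dots> \<le> real (2 * d) * surface_energy U (edges_of (box_vertices d L) (lattice_adj d)) h"
      by (rule box_cube_energy[OF U _ g_def]) (use zero in auto)
    finally show ?thesis using d by (simp add: field_simps)
  qed
  moreover have "c / real (2 * d) > 0" using c d by simp
  ultimately show ?thesis by blast
qed

text \<open>The periodic extension is compared at \<open>v\<close> and at the origin, whose
  coordinates differ by at most \<open>L \<le> 2 ^ K\<close>.\<close>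

lemma torus_energy_lower_bound:
  assumes d: "d \<ge> 3" and p: "p > 2" and U: "U = (\<lambda>x. \<bar>x\<bar> powr p + x\<^sup>2)"
  shows "\<exists>c>0. \<forall>L>0. \<forall>v\<in>torus_vertices d L. \<forall>t>2. \<forall>h.
    h (lattice_origin d) = 0 \<longrightarrow> t < \<bar>h v\<bar> \<longrightarrow>
    c * tail_rate d p t \<le> surface_energy U (edges_of (torus_vertices d L) (torus_adj d L)) h"
proof -
  obtain c where c: "c > 0" and bound: "\<forall>t>2. \<forall>g v w K.
    (\<forall>j<d. \<bar>v j - w j\<bar> \<le> 2 ^ K) \<longrightarrow> (\<forall>j\<ge>d. v j = w j) \<longrightarrow> t \<le> \<bar>g v - g w\<bar> \<longrightarrow>
    c * tail_rate d p t \<le> (\<Sum>i<d. cube_sum d (\<lambda>x. grad g i x powr p + (grad g i x)\<^sup>2) (2 ^ (K + 2))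
      (\<lambda>j. if j < d then v j - 2 ^ K else v j))"
    using grid_energy_lower_bound[OF d p] by (elim exE conjE)
  have "c / real (2 * 4 ^ d * d) * tail_rate d p t
      \<le> surface_energy U (edges_of (torus_vertices d L) (torus_adj d L)) h"
    if L: "L > 0" and v: "v \<in> torus_vertices d L" and t: "t > 2"
      and zero: "h (lattice_origin d) = 0" and h: "t < \<bar>h v\<bar>" for L v t h
  proof -
    obtain K where K: "int L \<le> 2 ^ K" "2 ^ K \<le> 2 * int L" using exists_power2_scale[OF L] by metis
    define g where "g = (\<lambda>x. h (torus_wrap d L x))"
    have vi: "- int L + 1 \<le> v i" "v i \<le> int L" if "i < d" for i
      using v that by (auto simp: torus_vertices_def PiE_def Pi_def)
    have vu: "v i = undefined" if "i \<ge> d" for i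
      using v that by (auto simp: torus_vertices_def PiE_def extensional_def)
    have wrap_id: "torus_wrap d L x = x"
      if "\<And>i. i < d \<Longrightarrow> - int L + 1 \<le> x i \<and> x i \<le> int L" "\<And>i. i \<ge> d \<Longrightarrow> x i = undefined" for x
    proof
      fix i show "torus_wrap d L x i = x i"
        using that[of i] by (cases "i < d") (auto simp: torus_wrap_def)
    qed
    have "g v = h v" using wrap_id[of v] vi vu by (simp add: g_def)
    moreover have "g (lattice_origin d) = 0"
      using wrap_id[of "lattice_origin d"] L zero by (simp add: g_def lattice_origin_def)
    ultimately have "t \<le> \<bar>g v - g (lattice_origin d)\<bar>" using h by simp
    moreover have "\<bar>v j - lattice_origin d j\<bar> \<le> 2 ^ K" if "j < d" for j
    proof -
      have "lattice_origin d j = 0" using that by (simp add: lattice_origin_def)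
      then show ?thesis using vi[OF that] K(1) by linarith
    qed
    ultimately have "c * tail_rate d p t \<le> (\<Sum>i<d. cube_sum d (\<lambda>x. grad g i x powr p + (grad g i x)\<^sup>2) (2 ^ (K + 2))
      (\<lambda>j. if j < d then v j - 2 ^ K else v j))"
      using vu by (intro bound[rule_format, OF t, of v "lattice_origin d"]) (auto simp: lattice_origin_def)
    also have "\<dots> \<le> real (2 * 4 ^ d * d) * surface_energy U (edges_of (torus_vertices d L) (torus_adj d L)) h"
      by (rule torus_cube_energy[OF U L _ g_def]) (use K in simp)
    finally show ?thesis using d by (simp add: field_simps)
  qed
  moreover have "c / real (2 * 4 ^ d * d) > 0" using c d by simp
  ultimately show ?thesis by blast
qed

theorem theorem1p5:
  fixes d :: nat and p :: real and U :: "real \<Rightarrow> real"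
  assumes "d \<ge> 3" and "p > 2"
    and U_def: "U = (\<lambda>x. \<bar>x\<bar> powr p + x\<^sup>2)"
  shows "\<exists>C>0. \<exists>c>0. \<forall>L\<ge>2. \<forall>\<mu> v.
    (\<mu> = torus_surface_measure d L U \<and> v \<in> torus_vertices d L - {lattice_origin d}) \<or>
    (\<mu> = box_surface_measure d L U \<and> v \<in> box_vertices d L - box_boundary d L) \<longrightarrow>
    (\<forall>t>2. \<P>(\<phi> in \<mu>. \<bar>\<phi> v\<bar> > t) \<le>
      (if real d < p then C * exp (- c * t ^ d)
       else if real d = p then C * exp (- c * (t ^ d / (ln t) ^ (d - 1)))
       else C * exp (- c * t powr p)))"
proof -
  obtain c1 where c1: "c1 > 0" and torus: "\<forall>L>0. \<forall>v\<in>torus_vertices d L. \<forall>t>2. \<forall>h.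
    h (lattice_origin d) = 0 \<longrightarrow> t < \<bar>h v\<bar> \<longrightarrow>
    c1 * tail_rate d p t \<le> surface_energy U (edges_of (torus_vertices d L) (torus_adj d L)) h"
    using torus_energy_lower_bound[OF assms] by (elim exE conjE)
  obtain c2 where c2: "c2 > 0" and box: "\<forall>L>0. \<forall>v\<in>box_vertices d L. \<forall>t>2. \<forall>h.
    (\<forall>x\<in>box_boundary d L. h x = 0) \<longrightarrow> t < \<bar>h v\<bar> \<longrightarrow>
    c2 * tail_rate d p t \<le> surface_energy U (edges_of (box_vertices d L) (lattice_adj d)) h"
    using box_energy_lower_bound[OF assms] by (elim exE conjE)
  define c where "c = min c1 c2"
  have c: "c > 0" using c1 c2 by (simp add: c_def)
  have p: "p \<ge> 2" using assms by simp
  have tail: "\<P>(\<phi> in \<mu>. \<bar>\<phi> v\<bar> > t) \<le> 2 * exp (- (c * tail_rate d p t))"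
    if L: "L \<ge> 2" and t: "t > 2"
      and \<mu>: "(\<mu> = torus_surface_measure d L U \<and> v \<in> torus_vertices d L - {lattice_origin d}) \<or>
        (\<mu> = box_surface_measure d L U \<and> v \<in> box_vertices d L - box_boundary d L)" for L \<mu> v t
    using \<mu>
  proof (elim disjE conjE)
    assume eq: "\<mu> = torus_surface_measure d L U" and v: "v \<in> torus_vertices d L - {lattice_origin d}"
    obtain \<omega> where \<omega>: "is_orientation (edges_of (torus_vertices d L) (torus_adj d L)) \<omega>"
      by (rule edges_of_orientation)
    have rate: "c * tail_rate d p t \<le> c1 * tail_rate d p t"
      using tail_rate_pos[OF t, of d p] by (simp add: c_def)
    \<comment> \<open>The boundary condition is available only at points of the vertex set.\<close>
    have origin: "lattice_origin d \<in> torus_vertices d L"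
      using L by (auto simp: lattice_origin_def torus_vertices_def)
    show ?thesis
      unfolding eq torus_surface_measure_def
    proof (rule random_surface_tail[OF p U_def finite_torus_vertices
          finite_edges_of[OF finite_torus_vertices] \<omega> edges_of_subset])
      fix h assume h: "\<And>x. x \<in> {lattice_origin d} \<Longrightarrow> x \<in> torus_vertices d L \<Longrightarrow> h x = 0" "t < \<bar>h v\<bar>"
      have "c1 * tail_rate d p t \<le> surface_energy U (edges_of (torus_vertices d L) (torus_adj d L)) h"
        using torus[rule_format, of L v t h] L v t h origin by simp
      then show "c * tail_rate d p t \<le> surface_energy U (edges_of (torus_vertices d L) (torus_adj d L)) h"
        using rate by simp
    qed (use v in auto)
  next
    assume eq: "\<mu> = box_surface_measure d L U" and v: "v \<in> box_vertices d L - box_boundary d L"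
    obtain \<omega> where \<omega>: "is_orientation (edges_of (box_vertices d L) (lattice_adj d)) \<omega>"
      by (rule edges_of_orientation)
    have rate: "c * tail_rate d p t \<le> c2 * tail_rate d p t"
      using tail_rate_pos[OF t, of d p] by (simp add: c_def)
    show ?thesis
      unfolding eq box_surface_measure_def
    proof (rule random_surface_tail[OF p U_def finite_box_vertices
          finite_edges_of[OF finite_box_vertices] \<omega> edges_of_subset])
      fix h assume h: "\<And>x. x \<in> box_boundary d L \<Longrightarrow> x \<in> box_vertices d L \<Longrightarrow> h x = 0" "t < \<bar>h v\<bar>"
      have "\<forall>x\<in>box_boundary d L. h x = 0" using h(1) by (auto simp: box_boundary_def)
      then have "c2 * tail_rate d p t \<le> surface_energy U (edges_of (box_vertices d L) (lattice_adj d)) h"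
        using box[rule_format, of L v t h] L v t h(2) by simp
      then show "c * tail_rate d p t \<le> surface_energy U (edges_of (box_vertices d L) (lattice_adj d)) h"
        using rate by simp
    qed (use v in auto)
  qed
  show ?thesis
  \<comment> \<open>The prefactor 2 comes from the two signs of \<open>\<phi> v\<close>;
    \<open>c\<close> serves torus and box alike.\<close>
  proof (rule exI[of _ 2], intro conjI, simp, intro exI[of _ c] conjI allI impI)
    fix L \<mu> v and t :: real
    assume L: "L \<ge> 2" and t: "t > 2"
      and \<mu>: "(\<mu> = torus_surface_measure d L U \<and> v \<in> torus_vertices d L - {lattice_origin d}) \<or>
        (\<mu> = box_surface_measure d L U \<and> v \<in> box_vertices d L - box_boundary d L)"
    show "\<P>(\<phi> in \<mu>. \<bar>\<phi> v\<bar> > t) \<le>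
      (if real d < p then 2 * exp (- c * t ^ d)
       else if real d = p then 2 * exp (- c * (t ^ d / (ln t) ^ (d - 1)))
       else 2 * exp (- c * t powr p))"
      using tail[OF L t \<mu>] by (simp add: tail_rate_def split: if_splits)
  qed (rule c)
qed

end
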